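(* Let $\mathcal A$ be a full subcategory, closed under extensions, of an $n$-angulated category $\mathcal T$, let $\mathfrak E$ be an almost $n$-exact structure for $\mathcal A$, and let $\mathcal I$, $\mathcal J$ be ideals in $\mathcal A$. (1) If $\mathcal I$ is a special precovering ideal, then $(\mathcal I,\mathcal I^\perp)$ is an ideal cotorsion pair. Moreover, if there are enough $\mathfrak E$-injective morphisms, then the ideal cotorsion pair $(\mathcal I,\mathcal I^\perp)$ is complete. (2) If $\mathcal J$ is a special preenveloping ideal, then $({}^\perp\mathcal J,\mathcal J)$ is an ideal cotorsion pair. Moreover, if there are enough $\mathfrak E$-projective morphisms, then the ideal cotorsion pair $({}^\perp\mathcal J,\mathcal J)$ is complete.
   Context: Let $n\geq 3$ be an integer. An $n$-angulated category is an additive category $\mathcal T$ with an automorphism $\Sigma$ and a collection of sequences $A_1\xrightarrow{\alpha_1}A_2\xrightarrow{\alpha_2}\cdots\xrightarrow{\alpha_{n-1}}A_n\xrightarrow{\alpha_n}\Sigma A_1$, called $n$-angles, satisfying the following (a morphism of such sequences is a tuple $(\varphi_1,\dots,\varphi_n)$ commuting with all maps, with $\Sigma\varphi_1$ on the last term). (F1) The collection is closed under direct sums and direct summands, contains $A\xrightarrow{1}A\to0\to\cdots\to0\to\Sigma A$ for all $A$, and every morphism $\alpha_1:A_1\to A_2$ is the first morphism of some $n$-angle. (F2) A sequence is an $n$-angle iff its left rotation $A_2\xrightarrow{\alpha_2}\cdots\xrightarrow{\alpha_n}\Sigma A_1\xrightarrow{(-1)^n\Sigma\alpha_1}\Sigma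 A_2$ is. (F3) Given two $n$-angles $(A_i,\alpha_i)$, $(B_i,\beta_i)$ and $\varphi_1,\varphi_2$ with $\varphi_2\alpha_1=\beta_1\varphi_1$, there are $\varphi_3,\dots,\varphi_n$ making $(\varphi_1,\dots,\varphi_n)$ a morphism. (F4) In (F3) these can be chosen so that the cone $A_2\oplus B_1\to A_3\oplus B_2\to\cdots\to\Sigma A_1\oplus B_n\to\Sigma A_2\oplus\Sigma B_1$, with maps $\begin{pmatrix}-\alpha_{i+1}&0\\ \varphi_{i+1}&\beta_i\end{pmatrix}$ ($1\le i\le n-1$) and finally $\begin{pmatrix}-\Sigma\alpha_1&0\\ \Sigma\varphi_1&\beta_n\end{pmatrix}$, is an $n$-angle. An $n$-angle is split if $\alpha_n=0$. $\mathcal A\subseteq\mathcal T$ is a full subcategory, closed under isomorphisms and closed under extensions: for every $n$-angle with $A_1,A_n\in\mathcal A$ also $A_2,\dots,A_{n-1}\in\mathcal A$. $\mathfrak D_{\mathcal A}$ is the class of all $n$-angles with $A_1,\dots,A_n\in\mathcal A$. A class $\mathfrak E\subseteq\mathfrak D_{\mathcal A}$ is an almost $n$-exact structure for $\mathcal A$ if: (N1) $\mathfrak E$ is closed under direct sums and contains all split $n$-angles (in $\mathfrak D_{\mathcal A}$); (N2) if $\mathfrak d\in\mathfrak E$ has last morphism $\alpha_n:A_n\to\Sigma A_1$ and $f:B_n\to A_n$ is in $\mathcal A$, then every $n$-angle $A_1\to B_2\to\cdots\to B_n\xrightarrow{\alpha_nf}\Sigma A_1$ admitting a morphism of $n$-angles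 $(1_{A_1},*,\dots,*,f)$ to $\mathfrak d$ is in $\mathfrak E$; (N3) if $\mathfrak d\in\mathfrak E$ is as before and $g:A_1\to C_1$ is in $\mathcal A$, then every $n$-angle $C_1\to C_2\to\cdots\to A_n\xrightarrow{(\Sigma g)\alpha_n}\Sigma C_1$ receiving a morphism of $n$-angles $(g,*,\dots,*,1_{A_n})$ from $\mathfrak d$ is in $\mathfrak E$. For an $n$-angle in $\mathfrak E$, $\alpha_1$ is called an $\mathfrak E$-inflation, $\alpha_{n-1}$ an $\mathfrak E$-deflation and $\alpha_n$ an $\mathfrak E$-phantom; $\Phi(\mathfrak E)$ is the class of all $\mathfrak E$-phantoms. A morphism $f:X\to A$ in $\mathcal A$ is $\mathfrak E$-projective if it factors through every $\mathfrak E$-deflation $A_{n-1}\to A$; $g:A\to Y$ in $\mathcal A$ is $\mathfrak E$-injective if it factors through every $\mathfrak E$-inflation $A\to A_2$. There are enough $\mathfrak E$-injective morphisms if for every $A\in\mathcal A$ there is an $\mathfrak E$-inflation $A\to E$ which is $\mathfrak E$-injective; enough $\mathfrak E$-projective morphisms if for every $C\in\mathcal A$ there is an $\mathfrak E$-deflation $P\to C$ which is $\mathfrak E$-projective. An ideal in $\mathcal A$ is a class of morphisms of $\mathcal A$ forming a subfunctor of the (additive) bifunctor $\mathrm{Hom}_{\mathcal A}(-,-)$. For morphisms $f:X\to A$, $g:B\to Y$ in $\mathcal A$, $f\perp g$ means $(\Sigma g)\phi f=0$ for all $\phi:A\to\Sigma B$ in $\Phi(\mathfrak E)$. For a class $\mathcal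 M$ of morphisms of $\mathcal A$, $\mathcal M^\perp=\{g: m\perp g\ \forall m\in\mathcal M\}$ and ${}^\perp\mathcal M=\{g: g\perp m\ \forall m\in\mathcal M\}$ (classes of morphisms of $\mathcal A$; they are ideals). A morphism $i:X\to A$ in an ideal $\mathcal I$ is a special $\mathcal I$-precover of $A$ if in the corresponding $n$-angle $A_1\to\cdots\to A_{n-2}\to X\xrightarrow{i}A\xrightarrow{\psi}\Sigma A_1$ one has $\psi=(\Sigma j)\phi$ with $j\in\mathcal I^\perp$, $\phi\in\Phi(\mathfrak E)$. A morphism $j:B\to Y$ in an ideal $\mathcal J$ is a special $\mathcal J$-preenvelope of $B$ if in the corresponding $n$-angle $B\xrightarrow{j}Y\to B_3\to\cdots\to B_n\xrightarrow{\psi}\Sigma B$ one has $\psi=\phi i$ with $i\in{}^\perp\mathcal J$, $\phi\in\Phi(\mathfrak E)$. An ideal is special precovering (special preenveloping) if every object of $\mathcal A$ has a special precover (special preenvelope) with respect to it. An ideal cotorsion pair (with respect to $\mathfrak E$) is a pair $(\mathcal I,\mathcal J)$ of ideals in $\mathcal A$ with $\mathcal J=\mathcal I^\perp$ and $\mathcal I={}^\perp\mathcal J$; it is complete if $\mathcal I$ is special precovering and $\mathcal J$ is special preenveloping. *)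

theory Defs
  imports "HOL-Algebra.Group"
begin

section \<open>Additive categories\<close>

text \<open>
  Morphisms carry their domain and codomain, so one operation \<open>Add\<close> serves all hom-sets;
  \<open>Add\<close> and \<open>Comp\<close> are unspecified on arguments that are not parallel (not composable).
  \<open>Comp C g f\<close>, written \<open>g \<cdot> f\<close>, means ``first \<open>f\<close>, then \<open>g\<close>''.
\<close>

record ('o, 'm) category_data =
  Obj :: "'o set"
  Arr :: "'m set"
  Dom :: "'m \<Rightarrow> 'o"
  Cod :: "'m \<Rightarrow> 'o"
  Id :: "'o \<Rightarrow> 'm"
  Comp :: "'m \<Rightarrow> 'm \<Rightarrow> 'm"  (infixr \<open>\<cdot>\<index>\<close> 70)

definition Hom :: "('o, 'm, 'z) category_data_scheme \<Rightarrow> 'o \<Rightarrow> 'o \<Rightarrow> 'm set" where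
  "Hom C X Y = {f \<in> Arr C. Dom C f = X \<and> Cod C f = Y}"

locale category =
  fixes C :: "('o, 'm, 'z) category_data_scheme" (structure)
  assumes dom_obj: "f \<in> Arr C \<Longrightarrow> Dom C f \<in> Obj C"
    and cod_obj: "f \<in> Arr C \<Longrightarrow> Cod C f \<in> Obj C"
    and id_hom: "X \<in> Obj C \<Longrightarrow> Id C X \<in> Hom C X X"
    and comp_hom: "\<lbrakk>f \<in> Hom C X Y; g \<in> Hom C Y Z\<rbrakk> \<Longrightarrow> g \<cdot> f \<in> Hom C X Z"
    and comp_id_left: "f \<in> Hom C X Y \<Longrightarrow> Id C Y \<cdot> f = f"
    and comp_id_right: "f \<in> Hom C X Y \<Longrightarrow> f \<cdot> Id C X = f"
    and comp_assoc: "\<lbrakk>f \<in> Hom C W X; g \<in> Hom C X Y; h \<in> Hom C Y Z\<rbrakk>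
                       \<Longrightarrow> (h \<cdot> g) \<cdot> f = h \<cdot> (g \<cdot> f)"

definition isomorphic :: "('o, 'm, 'z) category_data_scheme \<Rightarrow> 'o \<Rightarrow> 'o \<Rightarrow> bool" where
  "isomorphic C X Y \<longleftrightarrow>
     (\<exists>f \<in> Hom C X Y. \<exists>g \<in> Hom C Y X. g \<cdot>\<^bsub>C\<^esub> f = Id C X \<and> f \<cdot>\<^bsub>C\<^esub> g = Id C Y)"

record ('o, 'm) additive_data = "('o, 'm) category_data" +
  Add :: "'m \<Rightarrow> 'm \<Rightarrow> 'm"
  Zero :: "'o \<Rightarrow> 'o \<Rightarrow> 'm"

definition hom_group :: "('o, 'm, 'z) additive_data_scheme \<Rightarrow> 'o \<Rightarrow> 'o \<Rightarrow> 'm monoid" where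
  "hom_group C X Y = \<lparr>carrier = Hom C X Y, mult = Add C, one = Zero C X Y\<rparr>"

definition Neg :: "('o, 'm, 'z) additive_data_scheme \<Rightarrow> 'm \<Rightarrow> 'm" where
  "Neg C f = inv\<^bsub>hom_group C (Dom C f) (Cod C f)\<^esub> f"

definition zero_object :: "('o, 'm, 'z) additive_data_scheme \<Rightarrow> 'o \<Rightarrow> bool" where
  "zero_object C Z \<longleftrightarrow> Z \<in> Obj C \<and>
     (\<forall>X \<in> Obj C. Hom C Z X = {Zero C Z X} \<and> Hom C X Z = {Zero C X Z})"

definition biproduct ::
  "('o, 'm, 'z) additive_data_scheme \<Rightarrow> 'o \<Rightarrow> 'o \<Rightarrow> 'o \<Rightarrow> 'm \<Rightarrow> 'm \<Rightarrow> 'm \<Rightarrow> 'm \<Rightarrow> bool" where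
  "biproduct C X Y P i1 i2 p1 p2 \<longleftrightarrow>
     i1 \<in> Hom C X P \<and> i2 \<in> Hom C Y P \<and> p1 \<in> Hom C P X \<and> p2 \<in> Hom C P Y \<and>
     p1 \<cdot>\<^bsub>C\<^esub> i1 = Id C X \<and> p2 \<cdot>\<^bsub>C\<^esub> i2 = Id C Y \<and>
     p1 \<cdot>\<^bsub>C\<^esub> i2 = Zero C Y X \<and> p2 \<cdot>\<^bsub>C\<^esub> i1 = Zero C X Y \<and>
     Add C (i1 \<cdot>\<^bsub>C\<^esub> p1) (i2 \<cdot>\<^bsub>C\<^esub> p2) = Id C P"

locale additive_category = category C
  for C :: "('o, 'm, 'z) additive_data_scheme" (structure) +
  assumes hom_comm_group: "\<lbrakk>X \<in> Obj C; Y \<in> Obj C\<rbrakk> \<Longrightarrow> comm_group (hom_group C X Y)"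
    and comp_add_left: "\<lbrakk>f \<in> Hom C X Y; g \<in> Hom C Y Z; h \<in> Hom C Y Z\<rbrakk>
                          \<Longrightarrow> Add C g h \<cdot> f = Add C (g \<cdot> f) (h \<cdot> f)"
    and comp_add_right: "\<lbrakk>f \<in> Hom C X Y; g \<in> Hom C X Y; h \<in> Hom C Y Z\<rbrakk>
                           \<Longrightarrow> h \<cdot> Add C f g = Add C (h \<cdot> f) (h \<cdot> g)"
    and ex_zero_object: "\<exists>Z. zero_object C Z"
    and ex_biproduct: "\<lbrakk>X \<in> Obj C; Y \<in> Obj C\<rbrakk>
                         \<Longrightarrow> \<exists>P i1 i2 p1 p2. biproduct C X Y P i1 i2 p1 p2"


section \<open>\<open>n\<close>-angulated categories\<close>

text \<open>
  A sequence \<open>A\<^sub>1 \<rightarrow> A\<^sub>2 \<rightarrow> \<dots> \<rightarrow> A\<^sub>n \<rightarrow> \<Sigma>A\<^sub>1\<close> is the list \<open>[\<alpha>\<^sub>1, \<dots>, \<alpha>\<^sub>n]\<close> of its morphisms. List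
  positions start at \<open>0\<close>: \<open>\<alpha>\<^sub>i\<close> is \<open>\<alpha> ! (i - 1)\<close> and \<open>A\<^sub>i\<close> is \<open>Dom T (\<alpha> ! (i - 1))\<close>. In particular
  \<open>\<alpha>\<^sub>1\<close>, \<open>\<alpha>\<^bsub>n-1\<^esub>\<close>, \<open>\<alpha>\<^sub>n\<close> are \<open>hd \<alpha>\<close>, \<open>last (butlast \<alpha>)\<close>, \<open>last \<alpha>\<close>. \<open>SuspO\<close> and \<open>SuspA\<close> are the
  actions of \<open>\<Sigma>\<close> on objects and on morphisms.
\<close>

record ('o, 'm) angulated_data = "('o, 'm) additive_data" +
  SuspO :: "'o \<Rightarrow> 'o"
  SuspA :: "'m \<Rightarrow> 'm"
  Angles :: "'m list set"

definition is_seq :: "('o, 'm, 'z) angulated_data_scheme \<Rightarrow> nat \<Rightarrow> 'm list \<Rightarrow> bool" where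
  "is_seq T n \<alpha> \<longleftrightarrow> length \<alpha> = n \<and> set \<alpha> \<subseteq> Arr T \<and>
     (\<forall>k. Suc k < n \<longrightarrow> Cod T (\<alpha> ! k) = Dom T (\<alpha> ! Suc k)) \<and>
     Cod T (last \<alpha>) = SuspO T (Dom T (hd \<alpha>))"

definition seq_obj :: "('o, 'm, 'z) angulated_data_scheme \<Rightarrow> 'm list \<Rightarrow> nat \<Rightarrow> 'o" where
  "seq_obj T \<alpha> k = Dom T (\<alpha> ! k)"

definition seq_mor ::
  "('o, 'm, 'z) angulated_data_scheme \<Rightarrow> 'm list \<Rightarrow> 'm list \<Rightarrow> 'm list \<Rightarrow> bool" where
  "seq_mor T \<alpha> \<beta> \<phi> \<longleftrightarrow>
     length \<beta> = length \<alpha> \<and> length \<phi> = length \<alpha> \<and>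
     (\<forall>k < length \<alpha>. \<phi> ! k \<in> Hom T (seq_obj T \<alpha> k) (seq_obj T \<beta> k)) \<and>
     (\<forall>k. Suc k < length \<alpha> \<longrightarrow> \<phi> ! Suc k \<cdot>\<^bsub>T\<^esub> \<alpha> ! k = \<beta> ! k \<cdot>\<^bsub>T\<^esub> \<phi> ! k) \<and>
     SuspA T (hd \<phi>) \<cdot>\<^bsub>T\<^esub> last \<alpha> = last \<beta> \<cdot>\<^bsub>T\<^esub> last \<phi>"

text \<open>
  \<open>\<gamma>\<close> is a direct sum of \<open>\<alpha>\<close> and \<open>\<beta>\<close>: a biproduct in the category of sequences, which is formed
  termwise. It is determined up to isomorphism only.
\<close>

definition seq_direct_sum ::
  "('o, 'm, 'z) angulated_data_scheme \<Rightarrow> 'm list \<Rightarrow> 'm list \<Rightarrow> 'm list \<Rightarrow> bool" where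
  "seq_direct_sum T \<alpha> \<beta> \<gamma> \<longleftrightarrow>
     (\<exists>i1 i2 p1 p2.
        seq_mor T \<alpha> \<gamma> i1 \<and> seq_mor T \<beta> \<gamma> i2 \<and> seq_mor T \<gamma> \<alpha> p1 \<and> seq_mor T \<gamma> \<beta> p2 \<and>
        (\<forall>k < length \<gamma>. biproduct T (seq_obj T \<alpha> k) (seq_obj T \<beta> k) (seq_obj T \<gamma> k)
                          (i1 ! k) (i2 ! k) (p1 ! k) (p2 ! k)))"

definition trivial_seq ::
  "('o, 'm, 'z) angulated_data_scheme \<Rightarrow> nat \<Rightarrow> 'o \<Rightarrow> 'o \<Rightarrow> 'm list" where
  "trivial_seq T n Z X =
     [Id T X, Zero T X Z] @ replicate (n - 3) (Zero T Z Z) @ [Zero T Z (SuspO T X)]"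

definition rotate_seq :: "('o, 'm, 'z) angulated_data_scheme \<Rightarrow> 'm list \<Rightarrow> 'm list" where
  "rotate_seq T \<alpha> =
     tl \<alpha> @ [if even (length \<alpha>) then SuspA T (hd \<alpha>) else Neg T (SuspA T (hd \<alpha>))]"

text \<open>The periodic continuation \<open>\<alpha>\<^bsub>n+i\<^esub> = \<Sigma>\<alpha>\<^sub>i\<close>, used for \<open>1 \<le> i \<le> n\<close>.\<close>

definition ext :: "('o, 'm, 'z) angulated_data_scheme \<Rightarrow> 'm list \<Rightarrow> nat \<Rightarrow> 'm" where
  "ext T \<alpha> k = (if k < length \<alpha> then \<alpha> ! k else SuspA T (\<alpha> ! (k - length \<alpha>)))"

text \<open>
  \<open>\<gamma>\<close> is a cone of \<open>\<phi> : \<alpha> \<rightarrow> \<beta>\<close>: its \<open>i\<close>-th term is a biproduct of \<open>A\<^bsub>i+1\<^esub>\<close> and \<open>B\<^sub>i\<close>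
  (with \<open>A\<^bsub>n+1\<^esub> = \<Sigma>A\<^sub>1\<close>), the term \<open>\<Sigma>A\<^sub>2 \<oplus> \<Sigma>B\<^sub>1\<close> at the end has the \<open>\<Sigma>\<close>-image of the biproduct
  structure of the first term, and the four equations give the entries of the matrices. In the
  last matrix (\<open>k = n - 1\<close>), \<open>ext\<close> yields \<open>-\<Sigma>\<alpha>\<^sub>1\<close> and \<open>\<Sigma>\<phi>\<^sub>1\<close>.
\<close>

definition is_cone ::
  "('o, 'm, 'z) angulated_data_scheme \<Rightarrow> 'm list \<Rightarrow> 'm list \<Rightarrow> 'm list \<Rightarrow> 'm list \<Rightarrow> bool" where
  "is_cone T \<alpha> \<beta> \<phi> \<gamma> \<longleftrightarrow> is_seq T (length \<alpha>) \<gamma> \<and>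
     (\<exists>i1 i2 p1 p2.
        length i1 = length \<alpha> \<and> length i2 = length \<alpha> \<and>
        length p1 = length \<alpha> \<and> length p2 = length \<alpha> \<and>
        (\<forall>k < length \<alpha>.
           biproduct T (Dom T (ext T \<alpha> (Suc k))) (seq_obj T \<beta> k) (seq_obj T \<gamma> k)
             (i1 ! k) (i2 ! k) (p1 ! k) (p2 ! k) \<and>
           ext T p1 (Suc k) \<cdot>\<^bsub>T\<^esub> (\<gamma> ! k \<cdot>\<^bsub>T\<^esub> i1 ! k) = Neg T (ext T \<alpha> (Suc k)) \<and>
           ext T p1 (Suc k) \<cdot>\<^bsub>T\<^esub> (\<gamma> ! k \<cdot>\<^bsub>T\<^esub> i2 ! k) =
             Zero T (seq_obj T \<beta> k) (Cod T (ext T \<alpha> (Suc k))) \<and>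
           ext T p2 (Suc k) \<cdot>\<^bsub>T\<^esub> (\<gamma> ! k \<cdot>\<^bsub>T\<^esub> i1 ! k) = ext T \<phi> (Suc k) \<and>
           ext T p2 (Suc k) \<cdot>\<^bsub>T\<^esub> (\<gamma> ! k \<cdot>\<^bsub>T\<^esub> i2 ! k) = \<beta> ! k))"

text \<open>
  An automorphism of an additive category is taken to be additive (\<open>susp_add\<close>); this is automatic
  for an isomorphism of categories, since biproducts determine the addition. Zero objects and
  direct sums are only given up to isomorphism, so \<open>F1\<close> and \<open>F4\<close> range over all choices of them.
\<close>

locale n_angulated_category = additive_category T
  for n :: nat and T :: "('o, 'm, 'z) angulated_data_scheme" (structure) +
  assumes n_ge_3: "n \<ge> 3"
    and susp_bij_obj: "bij_betw (SuspO T) (Obj T) (Obj T)"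
    and susp_bij_arr: "bij_betw (SuspA T) (Arr T) (Arr T)"
    and susp_hom: "f \<in> Hom T X Y \<Longrightarrow> SuspA T f \<in> Hom T (SuspO T X) (SuspO T Y)"
    and susp_id: "X \<in> Obj T \<Longrightarrow> SuspA T (Id T X) = Id T (SuspO T X)"
    and susp_comp: "\<lbrakk>f \<in> Hom T X Y; g \<in> Hom T Y Z\<rbrakk>
                      \<Longrightarrow> SuspA T (g \<cdot> f) = SuspA T g \<cdot> SuspA T f"
    and susp_add: "\<lbrakk>f \<in> Hom T X Y; g \<in> Hom T X Y\<rbrakk>
                      \<Longrightarrow> SuspA T (Add T f g) = Add T (SuspA T f) (SuspA T g)"
    and angle_seq: "\<alpha> \<in> Angles T \<Longrightarrow> is_seq T n \<alpha>"
    and F1_sum: "\<lbrakk>\<alpha> \<in> Angles T; \<beta> \<in> Angles T; is_seq T n \<gamma>; seq_direct_sum T \<alpha> \<beta> \<gamma>\<rbrakk>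
                   \<Longrightarrow> \<gamma> \<in> Angles T"
    and F1_summand: "\<lbrakk>\<gamma> \<in> Angles T; is_seq T n \<alpha>; is_seq T n \<beta>; seq_direct_sum T \<alpha> \<beta> \<gamma>\<rbrakk>
                       \<Longrightarrow> \<alpha> \<in> Angles T \<and> \<beta> \<in> Angles T"
    and F1_trivial: "\<lbrakk>X \<in> Obj T; zero_object T Z\<rbrakk> \<Longrightarrow> trivial_seq T n Z X \<in> Angles T"
    and F1_complete: "f \<in> Arr T \<Longrightarrow> \<exists>\<alpha> \<in> Angles T. hd \<alpha> = f"
    and F2: "is_seq T n \<alpha> \<Longrightarrow> \<alpha> \<in> Angles T \<longleftrightarrow> rotate_seq T \<alpha> \<in> Angles T"
    and F3: "\<lbrakk>\<alpha> \<in> Angles T; \<beta> \<in> Angles T;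
               \<phi>1 \<in> Hom T (seq_obj T \<alpha> 0) (seq_obj T \<beta> 0);
               \<phi>2 \<in> Hom T (seq_obj T \<alpha> 1) (seq_obj T \<beta> 1);
               \<phi>2 \<cdot> \<alpha> ! 0 = \<beta> ! 0 \<cdot> \<phi>1\<rbrakk>
             \<Longrightarrow> \<exists>\<phi>. seq_mor T \<alpha> \<beta> \<phi> \<and> \<phi> ! 0 = \<phi>1 \<and> \<phi> ! 1 = \<phi>2"
    and F4: "\<lbrakk>\<alpha> \<in> Angles T; \<beta> \<in> Angles T;
               \<phi>1 \<in> Hom T (seq_obj T \<alpha> 0) (seq_obj T \<beta> 0);
               \<phi>2 \<in> Hom T (seq_obj T \<alpha> 1) (seq_obj T \<beta> 1);
               \<phi>2 \<cdot> \<alpha> ! 0 = \<beta> ! 0 \<cdot> \<phi>1\<rbrakk>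
             \<Longrightarrow> \<exists>\<phi>. seq_mor T \<alpha> \<beta> \<phi> \<and> \<phi> ! 0 = \<phi>1 \<and> \<phi> ! 1 = \<phi>2 \<and>
                     (\<forall>\<gamma>. is_cone T \<alpha> \<beta> \<phi> \<gamma> \<longrightarrow> \<gamma> \<in> Angles T)"

definition split_seq :: "('o, 'm, 'z) angulated_data_scheme \<Rightarrow> 'm list \<Rightarrow> bool" where
  "split_seq T \<alpha> \<longleftrightarrow> last \<alpha> = Zero T (Dom T (last \<alpha>)) (Cod T (last \<alpha>))"


section \<open>Almost \<open>n\<close>-exact structures\<close>

text \<open>A full subcategory is given by its set \<open>A\<close> of objects.\<close>

definition iso_closed :: "('o, 'm, 'z) angulated_data_scheme \<Rightarrow> 'o set \<Rightarrow> bool" where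
  "iso_closed T A \<longleftrightarrow> (\<forall>X \<in> A. \<forall>Y \<in> Obj T. isomorphic T X Y \<longrightarrow> Y \<in> A)"

definition extension_closed :: "('o, 'm, 'z) angulated_data_scheme \<Rightarrow> 'o set \<Rightarrow> bool" where
  "extension_closed T A \<longleftrightarrow>
     (\<forall>\<alpha> \<in> Angles T. Dom T (hd \<alpha>) \<in> A \<and> Dom T (last \<alpha>) \<in> A \<longrightarrow> (\<forall>f \<in> set \<alpha>. Dom T f \<in> A))"

definition sub_arr :: "('o, 'm, 'z) angulated_data_scheme \<Rightarrow> 'o set \<Rightarrow> 'm set" where
  "sub_arr T A = {f \<in> Arr T. Dom T f \<in> A \<and> Cod T f \<in> A}"

definition sub_angles :: "('o, 'm, 'z) angulated_data_scheme \<Rightarrow> 'o set \<Rightarrow> 'm list set" where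
  "sub_angles T A = {\<alpha> \<in> Angles T. \<forall>f \<in> set \<alpha>. Dom T f \<in> A}"

definition almost_n_exact_structure ::
  "('o, 'm, 'z) angulated_data_scheme \<Rightarrow> 'o set \<Rightarrow> 'm list set \<Rightarrow> bool" where
  "almost_n_exact_structure T A E \<longleftrightarrow>
     E \<subseteq> sub_angles T A \<and>
     \<comment> \<open>N1\<close>
     (\<forall>\<alpha> \<in> E. \<forall>\<beta> \<in> E. \<forall>\<gamma> \<in> Angles T. seq_direct_sum T \<alpha> \<beta> \<gamma> \<longrightarrow> \<gamma> \<in> E) \<and>
     (\<forall>\<alpha> \<in> sub_angles T A. split_seq T \<alpha> \<longrightarrow> \<alpha> \<in> E) \<and>
     \<comment> \<open>N2\<close>
     (\<forall>\<alpha> \<in> E. \<forall>f \<in> sub_arr T A. Cod T f = Dom T (last \<alpha>) \<longrightarrow>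
        (\<forall>\<beta> \<in> Angles T.
           Dom T (hd \<beta>) = Dom T (hd \<alpha>) \<and> Dom T (last \<beta>) = Dom T f \<and>
           last \<beta> = last \<alpha> \<cdot>\<^bsub>T\<^esub> f \<and>
           (\<exists>\<phi>. seq_mor T \<beta> \<alpha> \<phi> \<and> hd \<phi> = Id T (Dom T (hd \<alpha>)) \<and> last \<phi> = f)
           \<longrightarrow> \<beta> \<in> E)) \<and>
     \<comment> \<open>N3\<close>
     (\<forall>\<alpha> \<in> E. \<forall>g \<in> sub_arr T A. Dom T g = Dom T (hd \<alpha>) \<longrightarrow>
        (\<forall>\<beta> \<in> Angles T.
           Dom T (hd \<beta>) = Cod T g \<and> Dom T (last \<beta>) = Dom T (last \<alpha>) \<and>
           last \<beta> = SuspA T g \<cdot>\<^bsub>T\<^esub> last \<alpha> \<and>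
           (\<exists>\<phi>. seq_mor T \<alpha> \<beta> \<phi> \<and> hd \<phi> = g \<and> last \<phi> = Id T (Dom T (last \<alpha>)))
           \<longrightarrow> \<beta> \<in> E))"

definition inflations :: "'m list set \<Rightarrow> 'm set" where
  "inflations E = hd ` E"

definition deflations :: "'m list set \<Rightarrow> 'm set" where
  "deflations E = (\<lambda>\<alpha>. last (butlast \<alpha>)) ` E"

definition phantoms :: "'m list set \<Rightarrow> 'm set" where
  "phantoms E = last ` E"

definition projective_arr ::
  "('o, 'm, 'z) angulated_data_scheme \<Rightarrow> 'o set \<Rightarrow> 'm list set \<Rightarrow> 'm \<Rightarrow> bool" where
  "projective_arr T A E f \<longleftrightarrow> f \<in> sub_arr T A \<and>
     (\<forall>p \<in> deflations E. Cod T p = Cod T f \<longrightarrow>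
        (\<exists>h \<in> Hom T (Dom T f) (Dom T p). f = p \<cdot>\<^bsub>T\<^esub> h))"

definition injective_arr ::
  "('o, 'm, 'z) angulated_data_scheme \<Rightarrow> 'o set \<Rightarrow> 'm list set \<Rightarrow> 'm \<Rightarrow> bool" where
  "injective_arr T A E g \<longleftrightarrow> g \<in> sub_arr T A \<and>
     (\<forall>i \<in> inflations E. Dom T i = Dom T g \<longrightarrow>
        (\<exists>h \<in> Hom T (Cod T i) (Cod T g). g = h \<cdot>\<^bsub>T\<^esub> i))"

definition enough_injectives ::
  "('o, 'm, 'z) angulated_data_scheme \<Rightarrow> 'o set \<Rightarrow> 'm list set \<Rightarrow> bool" where
  "enough_injectives T A E \<longleftrightarrow>
     (\<forall>X \<in> A. \<exists>e \<in> inflations E. Dom T e = X \<and> injective_arr T A E e)"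

definition enough_projectives ::
  "('o, 'm, 'z) angulated_data_scheme \<Rightarrow> 'o set \<Rightarrow> 'm list set \<Rightarrow> bool" where
  "enough_projectives T A E \<longleftrightarrow>
     (\<forall>X \<in> A. \<exists>p \<in> deflations E. Cod T p = X \<and> projective_arr T A E p)"


section \<open>Ideal cotorsion pairs\<close>

definition arr_ideal :: "('o, 'm, 'z) angulated_data_scheme \<Rightarrow> 'o set \<Rightarrow> 'm set \<Rightarrow> bool" where
  "arr_ideal T A I \<longleftrightarrow> I \<subseteq> sub_arr T A \<and>
     (\<forall>X \<in> A. \<forall>Y \<in> A. subgroup (I \<inter> Hom T X Y) (hom_group T X Y)) \<and>
     (\<forall>f \<in> I. \<forall>a \<in> sub_arr T A. \<forall>b \<in> sub_arr T A.
        Cod T a = Dom T f \<and> Cod T f = Dom T b \<longrightarrow> b \<cdot>\<^bsub>T\<^esub> (f \<cdot>\<^bsub>T\<^esub> a) \<in> I)"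

definition perp :: "('o, 'm, 'z) angulated_data_scheme \<Rightarrow> 'm list set \<Rightarrow> 'm \<Rightarrow> 'm \<Rightarrow> bool" where
  "perp T E f g \<longleftrightarrow>
     (\<forall>\<phi> \<in> phantoms E \<inter> Hom T (Cod T f) (SuspO T (Dom T g)).
        SuspA T g \<cdot>\<^bsub>T\<^esub> (\<phi> \<cdot>\<^bsub>T\<^esub> f) = Zero T (Dom T f) (SuspO T (Cod T g)))"

definition right_perp ::
  "('o, 'm, 'z) angulated_data_scheme \<Rightarrow> 'o set \<Rightarrow> 'm list set \<Rightarrow> 'm set \<Rightarrow> 'm set" where
  "right_perp T A E M = {g \<in> sub_arr T A. \<forall>m \<in> M. perp T E m g}"

definition left_perp ::
  "('o, 'm, 'z) angulated_data_scheme \<Rightarrow> 'o set \<Rightarrow> 'm list set \<Rightarrow> 'm set \<Rightarrow> 'm set" where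
  "left_perp T A E M = {g \<in> sub_arr T A. \<forall>m \<in> M. perp T E g m}"

text \<open>
  The ``corresponding \<open>n\<close>-angle'' of a special precover (preenvelope) is not unique, as it may be
  changed by contractible summands; some \<open>n\<close>-angle with the stated last morphism is required.
  Such an \<open>n\<close>-angle belongs to \<open>E\<close> by \<open>F3\<close> and \<open>N3\<close> (\<open>N2\<close>).
\<close>

definition special_precover ::
  "('o, 'm, 'z) angulated_data_scheme \<Rightarrow> 'o set \<Rightarrow> 'm list set \<Rightarrow> 'm set \<Rightarrow> 'o \<Rightarrow> 'm \<Rightarrow> bool" where
  "special_precover T A E I X i \<longleftrightarrow> i \<in> I \<and> Cod T i = X \<and>
     (\<exists>\<alpha> \<in> Angles T. last (butlast \<alpha>) = i \<and>
        (\<exists>j \<in> right_perp T A E I. Cod T j = Dom T (hd \<alpha>) \<and>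
          (\<exists>\<phi> \<in> phantoms E \<inter> Hom T X (SuspO T (Dom T j)). last \<alpha> = SuspA T j \<cdot>\<^bsub>T\<^esub> \<phi>)))"

definition special_preenvelope ::
  "('o, 'm, 'z) angulated_data_scheme \<Rightarrow> 'o set \<Rightarrow> 'm list set \<Rightarrow> 'm set \<Rightarrow> 'o \<Rightarrow> 'm \<Rightarrow> bool" where
  "special_preenvelope T A E J X j \<longleftrightarrow> j \<in> J \<and> Dom T j = X \<and>
     (\<exists>\<alpha> \<in> Angles T. hd \<alpha> = j \<and>
        (\<exists>i \<in> left_perp T A E J. Dom T i = Dom T (last \<alpha>) \<and>
          (\<exists>\<phi> \<in> phantoms E \<inter> Hom T (Cod T i) (SuspO T X). last \<alpha> = \<phi> \<cdot>\<^bsub>T\<^esub> i)))"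

definition special_precovering ::
  "('o, 'm, 'z) angulated_data_scheme \<Rightarrow> 'o set \<Rightarrow> 'm list set \<Rightarrow> 'm set \<Rightarrow> bool" where
  "special_precovering T A E I \<longleftrightarrow> (\<forall>X \<in> A. \<exists>i. special_precover T A E I X i)"

definition special_preenveloping ::
  "('o, 'm, 'z) angulated_data_scheme \<Rightarrow> 'o set \<Rightarrow> 'm list set \<Rightarrow> 'm set \<Rightarrow> bool" where
  "special_preenveloping T A E J \<longleftrightarrow> (\<forall>X \<in> A. \<exists>j. special_preenvelope T A E J X j)"

definition ideal_cotorsion_pair ::
  "('o, 'm, 'z) angulated_data_scheme \<Rightarrow> 'o set \<Rightarrow> 'm list set \<Rightarrow> 'm set \<Rightarrow> 'm set \<Rightarrow> bool" where
  "ideal_cotorsion_pair T A E I J \<longleftrightarrow>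
     arr_ideal T A I \<and> arr_ideal T A J \<and> J = right_perp T A E I \<and> I = left_perp T A E J"

definition complete_ideal_cotorsion_pair ::
  "('o, 'm, 'z) angulated_data_scheme \<Rightarrow> 'o set \<Rightarrow> 'm list set \<Rightarrow> 'm set \<Rightarrow> 'm set \<Rightarrow> bool" where
  "complete_ideal_cotorsion_pair T A E I J \<longleftrightarrow>
     ideal_cotorsion_pair T A E I J \<and>
     special_precovering T A E I \<and> special_preenveloping T A E J"

end

theory Submission
  imports Defs
begin

text \<open>
  In an \<open>n\<close>-angle, a morphism into \<open>A\<^sub>n\<close> killed by \<open>\<alpha>\<^sub>n\<close> factors through \<open>\<alpha>\<^bsub>n-1\<^esub>\<close>. If
  \<open>f \<in> \<^sup>\<bottom>(I\<^sup>\<bottom>)\<close> and \<open>i\<close> is a special precover of the codomain of \<open>f\<close>, with \<open>n\<close>-angle ending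
  in \<open>(\<Sigma>j)\<phi>\<close>, then \<open>(\<Sigma>j)\<phi>f = 0\<close>, so \<open>f\<close> factors through \<open>i\<close> and lies in \<open>I\<close>. For
  completeness, Salce's argument: let \<open>\<alpha>\<close> start with an injective inflation \<open>e\<close> from \<open>B\<close>, and let
  \<open>i\<close> be a special precover of \<open>A\<^sub>n\<close>. Every phantom \<open>\<theta>\<close> into \<open>\<Sigma>B\<close> is killed by \<open>\<Sigma>e\<close>, hence
  \<open>\<theta> = \<alpha>\<^sub>nh\<close>; for \<open>m \<in> I\<close> also \<open>hm = ik\<close>, so \<open>\<theta>m\<close> factors through \<open>\<alpha>\<^sub>ni\<close> and is killed by the
  suspension of the first morphism \<open>g\<close> of an \<open>n\<close>-angle ending in \<open>\<alpha>\<^sub>ni\<close>. Thus \<open>g \<in> I\<^sup>\<bottom>\<close> is a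
  special preenvelope of \<open>B\<close>. Part (2) is dual.
\<close>

section \<open>Typing of morphisms and arithmetic in the hom-groups\<close>

context category
begin

lemma HomI: "f \<in> Arr C \<Longrightarrow> f \<in> Hom C (Dom C f) (Cod C f)"
  by (simp add: Hom_def)

lemma Hom_Arr: "f \<in> Hom C X Y \<Longrightarrow> f \<in> Arr C"
  and Hom_Dom: "f \<in> Hom C X Y \<Longrightarrow> Dom C f = X"
  and Hom_Cod: "f \<in> Hom C X Y \<Longrightarrow> Cod C f = Y"
  by (simp_all add: Hom_def)

lemma Hom_Obj: "f \<in> Hom C X Y \<Longrightarrow> X \<in> Obj C" "f \<in> Hom C X Y \<Longrightarrow> Y \<in> Obj C"
  using dom_obj cod_obj by (auto simp: Hom_def)

end

context additive_category
begin

lemma Zero_hom: "\<lbrakk>X \<in> Obj C; Y \<in> Obj C\<rbrakk> \<Longrightarrow> Zero C X Y \<in> Hom C X Y"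
  using comm_group.axioms(2)[OF hom_comm_group[of X Y]] group.is_monoid monoid.one_closed
  by (fastforce simp: hom_group_def)

lemma Add_hom: "\<lbrakk>f \<in> Hom C X Y; g \<in> Hom C X Y\<rbrakk> \<Longrightarrow> Add C f g \<in> Hom C X Y"
  using comm_group.axioms(2)[OF hom_comm_group[of X Y]] group.is_monoid Hom_Obj monoid.m_closed
  by (fastforce simp: hom_group_def)

lemma Neg_eq: "f \<in> Hom C X Y \<Longrightarrow> Neg C f = inv\<^bsub>hom_group C X Y\<^esub> f"
  by (simp add: Neg_def Hom_def)

lemma Neg_hom:
  assumes "f \<in> Hom C X Y" shows "Neg C f \<in> Hom C X Y"
proof -
  interpret comm_group "hom_group C X Y"
    using assms Hom_Obj hom_comm_group by blast
  show ?thesis using inv_closed[of f] assms by (simp add: Neg_eq[OF assms] hom_group_def)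
qed

lemma Neg_Neg:
  assumes "f \<in> Hom C X Y" shows "Neg C (Neg C f) = f"
proof -
  interpret comm_group "hom_group C X Y"
    using assms Hom_Obj hom_comm_group by blast
  show ?thesis using inv_inv[of f] assms Neg_eq[OF Neg_hom[OF assms]]
    by (simp add: Neg_eq[OF assms] hom_group_def)
qed

lemma Add_Neg:
  assumes "f \<in> Hom C X Y" shows "Add C f (Neg C f) = Zero C X Y"
proof -
  interpret comm_group "hom_group C X Y"
    using assms Hom_Obj hom_comm_group by blast
  show ?thesis using r_inv[of f] assms by (simp add: Neg_eq[OF assms] hom_group_def)
qed

text \<open>Reduces compatibility with \<open>Neg\<close>, for composition on either side and for
  \<open>SuspA\<close>, to additivity.\<close>

lemma Neg_unique:
  assumes "f \<in> Hom C X Y" "g \<in> Hom C X Y" "Add C f g = Zero C X Y" shows "g = Neg C f"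
proof -
  interpret comm_group "hom_group C X Y"
    using assms Hom_Obj hom_comm_group by blast
  show ?thesis using inv_unique'[of f g] m_comm[of f g] assms
    by (simp add: Neg_eq[OF assms(1)] hom_group_def)
qed

text \<open>Additive operations send a zero morphism to an idempotent for \<open>Add\<close>. This
  is how composition and \<open>SuspA\<close> are shown to preserve zeros.\<close>

lemma Add_idem_imp_Zero:
  assumes "f \<in> Hom C X Y" "Add C f f = f" shows "f = Zero C X Y"
proof -
  interpret comm_group "hom_group C X Y"
    using assms Hom_Obj hom_comm_group by blast
  show ?thesis using l_cancel_one[of f f] assms by (simp add: hom_group_def)
qed

lemma Add_Zero_Zero:
  assumes "X \<in> Obj C" "Y \<in> Obj C" shows "Add C (Zero C X Y) (Zero C X Y) = Zero C X Y"
proof -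
  interpret comm_group "hom_group C X Y"
    using assms hom_comm_group by blast
  show ?thesis using l_one[OF one_closed] by (simp add: hom_group_def)
qed

lemma Neg_Zero:
  assumes "X \<in> Obj C" "Y \<in> Obj C" shows "Neg C (Zero C X Y) = Zero C X Y"
  using Neg_unique[OF Zero_hom[OF assms] Zero_hom[OF assms] Add_Zero_Zero[OF assms]] by simp

lemma comp_Zero:
  assumes "g \<in> Hom C Y Z" "X \<in> Obj C" shows "g \<cdot> Zero C X Y = Zero C X Z"
proof -
  have z: "Zero C X Y \<in> Hom C X Y" using assms Hom_Obj Zero_hom by blast
  show ?thesis
    using Add_idem_imp_Zero[OF comp_hom[OF z assms(1)]] comp_add_right[OF z z assms(1)]
      Add_Zero_Zero Hom_Obj[OF z] Hom_Obj[OF assms(1)] assms(2) by simp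
qed

lemma Zero_comp:
  assumes "f \<in> Hom C X Y" "Z \<in> Obj C" shows "Zero C Y Z \<cdot> f = Zero C X Z"
proof -
  have z: "Zero C Y Z \<in> Hom C Y Z" using assms Hom_Obj Zero_hom by blast
  show ?thesis
    using Add_idem_imp_Zero[OF comp_hom[OF assms(1) z]] comp_add_left[OF assms(1) z z]
      Add_Zero_Zero Hom_Obj[OF z] Hom_Obj[OF assms(1)] assms(2) by simp
qed

lemma comp_Neg:
  assumes "f \<in> Hom C X Y" "g \<in> Hom C Y Z" shows "g \<cdot> Neg C f = Neg C (g \<cdot> f)"
proof (rule Neg_unique)
  have n: "Neg C f \<in> Hom C X Y" using assms Neg_hom by blast
  show "g \<cdot> f \<in> Hom C X Z" "g \<cdot> Neg C f \<in> Hom C X Z"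
    using comp_hom assms n by blast+
  show "Add C (g \<cdot> f) (g \<cdot> Neg C f) = Zero C X Z"
    using comp_add_right[OF assms(1) n assms(2)] Add_Neg[OF assms(1)]
      comp_Zero[OF assms(2)] Hom_Obj[OF n] by simp
qed

lemma Neg_comp:
  assumes "f \<in> Hom C X Y" "g \<in> Hom C Y Z" shows "Neg C g \<cdot> f = Neg C (g \<cdot> f)"
proof (rule Neg_unique)
  have n: "Neg C g \<in> Hom C Y Z" using assms Neg_hom by blast
  show "g \<cdot> f \<in> Hom C X Z" "Neg C g \<cdot> f \<in> Hom C X Z"
    using comp_hom assms n by blast+
  show "Add C (g \<cdot> f) (Neg C g \<cdot> f) = Zero C X Z"
    using comp_add_left[OF assms(1) assms(2) n] Add_Neg[OF assms(2)]
      Zero_comp[OF assms(1)] Hom_Obj[OF n] by simp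
qed

end

context n_angulated_category
begin

section \<open>Suspension and rotation\<close>

lemma SuspO_obj: "X \<in> Obj T \<Longrightarrow> SuspO T X \<in> Obj T"
  using susp_bij_obj bij_betwE by blast

lemma SuspO_inj: "\<lbrakk>SuspO T X = SuspO T Y; X \<in> Obj T; Y \<in> Obj T\<rbrakk> \<Longrightarrow> X = Y"
  using susp_bij_obj by (meson bij_betw_imp_inj_on inj_onD)

lemma SuspO_surj:
  assumes "Y \<in> Obj T" obtains X where "X \<in> Obj T" "SuspO T X = Y"
  using susp_bij_obj assms by (metis bij_betw_imp_surj_on imageE)

lemma SuspA_inj: "\<lbrakk>SuspA T f = SuspA T g; f \<in> Arr T; g \<in> Arr T\<rbrakk> \<Longrightarrow> f = g"
  using susp_bij_arr by (meson bij_betw_imp_inj_on inj_onD)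

text \<open>Bijectivity on arrows yields a preimage without a type; injectivity of
  \<open>SuspO\<close> then identifies its domain and codomain. Every desuspension of a morphism
  below goes through this.\<close>

lemma SuspA_full:
  assumes "f \<in> Hom T (SuspO T X) (SuspO T Y)" "X \<in> Obj T" "Y \<in> Obj T"
  obtains g where "g \<in> Hom T X Y" "SuspA T g = f"
proof -
  obtain g where g: "g \<in> Arr T" "SuspA T g = f"
    using susp_bij_arr Hom_Arr[OF assms(1)] by (metis bij_betw_imp_surj_on imageE)
  have "f \<in> Hom T (SuspO T (Dom T g)) (SuspO T (Cod T g))"
    using susp_hom[OF HomI[OF g(1)]] g(2) by simp
  then have "Dom T g = X" "Cod T g = Y"
    using assms SuspO_inj dom_obj[OF g(1)] cod_obj[OF g(1)] by (auto simp: Hom_def)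
  then show thesis using that HomI[OF g(1)] g(2) by blast
qed

lemma SuspA_Zero:
  assumes "X \<in> Obj T" "Y \<in> Obj T"
  shows "SuspA T (Zero T X Y) = Zero T (SuspO T X) (SuspO T Y)"
  using Add_idem_imp_Zero[OF susp_hom[OF Zero_hom[OF assms]]]
    susp_add[OF Zero_hom[OF assms] Zero_hom[OF assms]] Add_Zero_Zero[OF assms] by simp

lemma SuspA_Neg:
  assumes "f \<in> Hom T X Y" shows "SuspA T (Neg T f) = Neg T (SuspA T f)"
  using Neg_unique[OF susp_hom[OF assms] susp_hom[OF Neg_hom[OF assms]]]
    susp_add[OF assms Neg_hom[OF assms]] Add_Neg[OF assms] SuspA_Zero Hom_Obj[OF assms]
  by simp

lemma SuspA_eq_ZeroD:
  assumes "SuspA T f = Zero T (SuspO T X) (SuspO T Y)" "f \<in> Hom T X Y"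
  shows "f = Zero T X Y"
  using SuspA_inj[OF _ Hom_Arr[OF assms(2)] Hom_Arr[OF Zero_hom[OF Hom_Obj[OF assms(2)]]]]
    SuspA_Zero[OF Hom_Obj[OF assms(2)]] assms(1) by simp

text \<open>The sign \<open>(-1)\<^sup>n\<close> of the rotation axiom.\<close>

definition rot_sign :: "'m \<Rightarrow> 'm" where
  "rot_sign f = (if even n then f else Neg T f)"

lemma rot_sign_hom: "f \<in> Hom T X Y \<Longrightarrow> rot_sign f \<in> Hom T X Y"
  by (simp add: rot_sign_def Neg_hom)

lemma rot_sign_rot_sign: "f \<in> Hom T X Y \<Longrightarrow> rot_sign (rot_sign f) = f"
  by (simp add: rot_sign_def Neg_Neg)

lemma rot_sign_Zero: "\<lbrakk>X \<in> Obj T; Y \<in> Obj T\<rbrakk> \<Longrightarrow> rot_sign (Zero T X Y) = Zero T X Y"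
  by (simp add: rot_sign_def Neg_Zero)

lemma comp_rot_sign:
  "\<lbrakk>f \<in> Hom T X Y; g \<in> Hom T Y Z\<rbrakk> \<Longrightarrow> g \<cdot> rot_sign f = rot_sign (g \<cdot> f)"
  by (simp add: rot_sign_def comp_Neg)

lemma rot_sign_comp:
  "\<lbrakk>f \<in> Hom T X Y; g \<in> Hom T Y Z\<rbrakk> \<Longrightarrow> rot_sign g \<cdot> f = rot_sign (g \<cdot> f)"
  by (simp add: rot_sign_def Neg_comp)

lemma SuspA_rot_sign: "f \<in> Hom T X Y \<Longrightarrow> SuspA T (rot_sign f) = rot_sign (SuspA T f)"
  by (simp add: rot_sign_def SuspA_Neg)

section \<open>Typing of sequences, of their morphisms and of angles\<close>

lemma seq_nth_hom:
  assumes "is_seq T n \<alpha>" "Suc k < n"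
  shows "\<alpha> ! k \<in> Hom T (seq_obj T \<alpha> k) (seq_obj T \<alpha> (Suc k))"
  using assms by (auto simp: is_seq_def Hom_def seq_obj_def subset_iff)

lemma seq_last_hom:
  assumes "is_seq T n \<alpha>"
  shows "last \<alpha> \<in> Hom T (seq_obj T \<alpha> (n - 1)) (SuspO T (seq_obj T \<alpha> 0))"
proof -
  have "\<alpha> \<noteq> []" using assms n_ge_3 by (auto simp: is_seq_def)
  then show ?thesis
    using assms by (auto simp: is_seq_def Hom_def seq_obj_def last_conv_nth hd_conv_nth)
qed

lemma seq_last_butlast:
  assumes "length \<alpha> = n" shows "last (butlast \<alpha>) = \<alpha> ! (n - 2)" "butlast \<alpha> \<noteq> []"
proof -
  have l: "length (butlast \<alpha>) = n - 1" using assms by simp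
  then show ne: "butlast \<alpha> \<noteq> []" using n_ge_3 by (auto simp flip: length_0_conv)
  show "last (butlast \<alpha>) = \<alpha> ! (n - 2)"
    using l ne n_ge_3 assms by (simp add: last_conv_nth nth_butlast numeral_2_eq_2)
qed

lemma seq_mor_hd_last:
  assumes "seq_mor T \<alpha> \<beta> \<phi>" "length \<alpha> = n"
  shows "hd \<phi> = \<phi> ! 0" "last \<phi> = \<phi> ! (n - 1)"
proof -
  have "length \<phi> = n" using assms by (simp add: seq_mor_def)
  moreover from this have "\<phi> \<noteq> []" using n_ge_3 by auto
  ultimately show "hd \<phi> = \<phi> ! 0" "last \<phi> = \<phi> ! (n - 1)"
    by (simp_all add: hd_conv_nth last_conv_nth)
qed

lemma seq_mor_nth_hom:
  "\<lbrakk>seq_mor T \<alpha> \<beta> \<phi>; k < length \<alpha>\<rbrakk> \<Longrightarrow> \<phi> ! k \<in> Hom T (seq_obj T \<alpha> k) (seq_obj T \<beta> k)"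
  by (simp add: seq_mor_def)

text \<open>The typing facts of one angle, cited by item number throughout. Positions are
  zero-based: \<open>n - 2\<close> and \<open>n - 1\<close> stand for the last two of the objects
  \<open>A\<^sub>1\<close> to \<open>A\<^sub>n\<close>.\<close>

lemma angle_homs:
  assumes "\<alpha> \<in> Angles T"
  shows "length \<alpha> = n" "\<alpha> \<noteq> []" "hd \<alpha> = \<alpha> ! 0" "last \<alpha> = \<alpha> ! (n - 1)"
    "last (butlast \<alpha>) = \<alpha> ! (n - 2)"
    "hd \<alpha> \<in> Hom T (seq_obj T \<alpha> 0) (seq_obj T \<alpha> 1)"
    "last (butlast \<alpha>) \<in> Hom T (seq_obj T \<alpha> (n - 2)) (seq_obj T \<alpha> (n - 1))"
    "last \<alpha> \<in> Hom T (seq_obj T \<alpha> (n - 1)) (SuspO T (seq_obj T \<alpha> 0))"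
    "seq_obj T \<alpha> 0 = Dom T (hd \<alpha>)" "seq_obj T \<alpha> (n - 1) = Dom T (last \<alpha>)"
    "seq_obj T \<alpha> 0 \<in> Obj T" "seq_obj T \<alpha> (n - 1) \<in> Obj T"
proof -
  have s: "is_seq T n \<alpha>" using assms angle_seq by blast
  show l: "length \<alpha> = n" using s by (simp add: is_seq_def)
  show ne: "\<alpha> \<noteq> []" using l n_ge_3 by auto
  show h: "hd \<alpha> = \<alpha> ! 0" "last \<alpha> = \<alpha> ! (n - 1)" using ne l by (simp_all add: hd_conv_nth last_conv_nth)
  show b: "last (butlast \<alpha>) = \<alpha> ! (n - 2)" using seq_last_butlast l by blast
  show hh: "hd \<alpha> \<in> Hom T (seq_obj T \<alpha> 0) (seq_obj T \<alpha> 1)"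
    using seq_nth_hom[OF s, of 0] n_ge_3 h by simp
  have "Suc (n - 2) = n - 1" using n_ge_3 by simp
  then show "last (butlast \<alpha>) \<in> Hom T (seq_obj T \<alpha> (n - 2)) (seq_obj T \<alpha> (n - 1))"
    using seq_nth_hom[OF s, of "n - 2"] n_ge_3 b by simp
  show lh: "last \<alpha> \<in> Hom T (seq_obj T \<alpha> (n - 1)) (SuspO T (seq_obj T \<alpha> 0))"
    using seq_last_hom s by blast
  show "seq_obj T \<alpha> 0 = Dom T (hd \<alpha>)" "seq_obj T \<alpha> (n - 1) = Dom T (last \<alpha>)"
    by (simp_all add: seq_obj_def h)
  show "seq_obj T \<alpha> 0 \<in> Obj T" "seq_obj T \<alpha> (n - 1) \<in> Obj T" using Hom_Obj hh lh by blast+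
qed

text \<open>\<open>F2\<close> read backwards. Questions about the end of an angle are moved to its
  start, the place of which \<open>F1\<close> and \<open>F3\<close> speak.\<close>

lemma inverse_rotation:
  assumes "\<alpha> \<in> Angles T"
  obtains \<beta> where "\<beta> \<in> Angles T" "\<forall>k. Suc k < n \<longrightarrow> \<beta> ! Suc k = \<alpha> ! k"
    "last \<beta> = last (butlast \<alpha>)" "SuspA T (hd \<beta>) = rot_sign (last \<alpha>)"
    "SuspO T (seq_obj T \<beta> 0) = seq_obj T \<alpha> (n - 1)" "seq_obj T \<beta> 1 = seq_obj T \<alpha> 0"
    "hd \<beta> \<in> Hom T (seq_obj T \<beta> 0) (seq_obj T \<alpha> 0)"
proof -
  note a = angle_homs[OF assms]
  have s: "is_seq T n \<alpha>" using assms angle_seq by blast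
  obtain X where X: "X \<in> Obj T" "SuspO T X = seq_obj T \<alpha> (n - 1)"
    using SuspO_surj a(12) by blast
  \<comment> \<open>The new first morphism is the desuspension of \<open>\<alpha>\<^sub>n\<close>
    with the sign (-1)^n already applied, since rotating applies that sign once more.\<close>
  obtain f where f: "f \<in> Hom T X (seq_obj T \<alpha> 0)" "SuspA T f = rot_sign (last \<alpha>)"
    using SuspA_full[OF _ X(1) a(11), of "rot_sign (last \<alpha>)"] rot_sign_hom[OF a(8)] X(2) by auto
  define \<beta> where "\<beta> = f # butlast \<alpha>"
  have bn: "\<beta> ! Suc k = \<alpha> ! k" if "Suc k < n" for k
    using that a(1) by (simp add: \<beta>_def nth_butlast)
  have bl: "last \<beta> = last (butlast \<alpha>)"
    using seq_last_butlast(2)[OF a(1)] by (simp add: \<beta>_def)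
  have len: "length \<beta> = n" using a(1) n_ge_3 by (simp add: \<beta>_def)
  have sb: "is_seq T n \<beta>"
    unfolding is_seq_def
  proof (intro conjI allI impI)
    show "length \<beta> = n" by fact
    show "set \<beta> \<subseteq> Arr T"
      using s f Hom_Arr by (auto simp: \<beta>_def is_seq_def dest: in_set_butlastD)
    show "Cod T (last \<beta>) = SuspO T (Dom T (hd \<beta>))"
      using bl Hom_Cod[OF a(7)] X(2) Hom_Dom[OF f(1)] by (simp add: \<beta>_def)
    fix k assume k: "Suc k < n"
    show "Cod T (\<beta> ! k) = Dom T (\<beta> ! Suc k)"
    \<comment> \<open>At \<open>k = 0\<close> the new morphism \<open>f\<close> meets
      \<open>\<alpha>\<^sub>1\<close>; all other junctions are those of \<open>\<alpha>\<close>,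
      shifted by one.\<close>
    proof (cases k)
      case 0
      then show ?thesis using bn[OF k] Hom_Cod[OF f(1)] by (simp add: \<beta>_def seq_obj_def)
    next
      case (Suc j)
      then show ?thesis using bn[OF k] bn[of j] k s by (simp add: is_seq_def)
    qed
  qed
  have "rotate_seq T \<beta> = butlast \<alpha> @ [rot_sign (SuspA T f)]"
    using len by (simp add: rotate_seq_def rot_sign_def \<beta>_def)
  also have "\<dots> = \<alpha>" using f(2) rot_sign_rot_sign[OF a(8)] a(2) by simp
  finally have "\<beta> \<in> Angles T" using F2[OF sb] assms by simp
  moreover have "seq_obj T \<beta> 1 = seq_obj T \<alpha> 0"
    using bn[of 0] n_ge_3 by (simp add: seq_obj_def)
  moreover have "seq_obj T \<beta> 0 = X" using Hom_Dom[OF f(1)] by (simp add: seq_obj_def \<beta>_def)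
  ultimately show thesis using that[of \<beta>] bn bl f X by (simp add: \<beta>_def)
qed

text \<open>\<open>F1\<close> prescribes the first morphism of an angle. To prescribe the last one,
  complete the signed desuspension of \<open>f\<close> and rotate: the suspension of the first
  morphism moves to the end and the two signs cancel.\<close>

lemma ex_angle_last:
  assumes "f \<in> Hom T X (SuspO T Y)" "Y \<in> Obj T"
  obtains \<alpha> where "\<alpha> \<in> Angles T" "last \<alpha> = f" "seq_obj T \<alpha> 0 = Y" "seq_obj T \<alpha> (n - 1) = X"
proof -
  obtain X' where X': "X' \<in> Obj T" "SuspO T X' = X" using SuspO_surj Hom_Obj[OF assms(1)] by blast
  obtain g where g: "g \<in> Hom T X' Y" "SuspA T g = rot_sign f"
    using SuspA_full[OF _ X'(1) assms(2), of "rot_sign f"] rot_sign_hom[OF assms(1)] X'(2) by auto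
  obtain \<beta> where b: "\<beta> \<in> Angles T" "hd \<beta> = g" using F1_complete Hom_Arr[OF g(1)] by blast
  note bb = angle_homs[OF b(1)]
  define \<alpha> where "\<alpha> = rotate_seq T \<beta>"
  have a: "\<alpha> \<in> Angles T" using F2[OF angle_seq[OF b(1)]] b(1) by (simp add: \<alpha>_def)
  have al: "last \<alpha> = f"
    using b(2) g(2) rot_sign_rot_sign[OF assms(1)] bb(1)
    by (auto simp: \<alpha>_def rotate_seq_def rot_sign_def split: if_splits)
  have "seq_obj T \<alpha> 0 = Y"
    using SuspO_inj[OF _ angle_homs(11)[OF a] assms(2)] Hom_Cod[OF angle_homs(8)[OF a]]
      Hom_Cod[OF assms(1)] al by simp
  then show thesis using that a al angle_homs(10)[OF a] Hom_Dom[OF assms(1)] by simp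
qed

text \<open>
  The axiom \<open>F3\<close> for \<open>\<phi>\<^sub>1\<close> and \<open>\<phi>\<^sub>n\<close> instead of \<open>\<phi>\<^sub>1\<close> and \<open>\<phi>\<^sub>2\<close>, by passing to the inverse
  rotations. It provides the morphisms of \<open>n\<close>-angles demanded in \<open>N2\<close> and \<open>N3\<close>.
\<close>

lemma ex_seq_mor_first_last:
  assumes "\<alpha> \<in> Angles T" "\<beta> \<in> Angles T"
    and f: "f \<in> Hom T (seq_obj T \<alpha> 0) (seq_obj T \<beta> 0)"
    and g: "g \<in> Hom T (seq_obj T \<alpha> (n - 1)) (seq_obj T \<beta> (n - 1))"
    and eq: "last \<beta> \<cdot> g = SuspA T f \<cdot> last \<alpha>"
  obtains \<phi> where "seq_mor T \<alpha> \<beta> \<phi>" "hd \<phi> = f" "last \<phi> = g"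
proof -
  note a = angle_homs[OF assms(1)] and b = angle_homs[OF assms(2)]
  obtain \<alpha>' where a': "\<alpha>' \<in> Angles T" "\<forall>k. Suc k < n \<longrightarrow> \<alpha>' ! Suc k = \<alpha> ! k"
    "last \<alpha>' = last (butlast \<alpha>)" "SuspA T (hd \<alpha>') = rot_sign (last \<alpha>)"
    "SuspO T (seq_obj T \<alpha>' 0) = seq_obj T \<alpha> (n - 1)" "seq_obj T \<alpha>' 1 = seq_obj T \<alpha> 0"
    "hd \<alpha>' \<in> Hom T (seq_obj T \<alpha>' 0) (seq_obj T \<alpha> 0)"
    by (rule inverse_rotation[OF assms(1)])
  obtain \<beta>' where b': "\<beta>' \<in> Angles T" "\<forall>k. Suc k < n \<longrightarrow> \<beta>' ! Suc k = \<beta> ! k"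
    "last \<beta>' = last (butlast \<beta>)" "SuspA T (hd \<beta>') = rot_sign (last \<beta>)"
    "SuspO T (seq_obj T \<beta>' 0) = seq_obj T \<beta> (n - 1)" "seq_obj T \<beta>' 1 = seq_obj T \<beta> 0"
    "hd \<beta>' \<in> Hom T (seq_obj T \<beta>' 0) (seq_obj T \<beta> 0)"
    by (rule inverse_rotation[OF assms(2)])
  note aa = angle_homs[OF a'(1)] and bb = angle_homs[OF b'(1)]
  \<comment> \<open>In the inverse rotations the first objects are the desuspended last objects, so
    the first component has to be the desuspension of \<open>g\<close>.\<close>
  obtain h where h: "h \<in> Hom T (seq_obj T \<alpha>' 0) (seq_obj T \<beta>' 0)" "SuspA T h = g"
    using SuspA_full[of g "seq_obj T \<alpha>' 0" "seq_obj T \<beta>' 0"] g a'(5) b'(5) aa(11) bb(11) by auto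
  \<comment> \<open>After suspension, the first square of the inverse rotations is \<open>eq\<close>
    up to the common sign.\<close>
  have "SuspA T (f \<cdot> hd \<alpha>') = SuspA T (hd \<beta>' \<cdot> h)"
    using susp_comp[OF a'(7) f] susp_comp[OF h(1) b'(7)] a'(4) b'(4) h(2) eq
      comp_rot_sign[OF a(8) susp_hom[OF f]] rot_sign_comp[OF g b(8)] by simp
  then have "f \<cdot> hd \<alpha>' = hd \<beta>' \<cdot> h"
    using SuspA_inj comp_hom[OF a'(7) f] comp_hom[OF h(1) b'(7)] Hom_Arr by blast
  then obtain \<chi> where chi: "seq_mor T \<alpha>' \<beta>' \<chi>" "\<chi> ! 0 = h" "\<chi> ! 1 = f"
    using F3[OF a'(1) b'(1) h(1), of f] f a'(6) b'(6) aa(3) bb(3) by auto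
  have len: "length \<chi> = n" using chi(1) aa(1) by (simp add: seq_mor_def)
  then have ne: "\<chi> \<noteq> []" "tl \<chi> \<noteq> []" using n_ge_3 by (auto simp flip: length_0_conv)
  \<comment> \<open>Dropping \<open>h\<close> in front and appending its suspension \<open>g\<close>
    rotates \<open>\<chi>\<close> back.\<close>
  define \<phi> where "\<phi> = tl \<chi> @ [g]"
  have pk: "\<phi> ! k = \<chi> ! Suc k" if "Suc k < n" for k
    using that len by (auto simp: \<phi>_def nth_append nth_tl)
  have pl: "\<phi> ! (n - 1) = g" using len by (simp add: \<phi>_def nth_append)
  have lp: "length \<phi> = n" using len n_ge_3 by (simp add: \<phi>_def)
  have hp: "hd \<phi> = f" using chi(3) pk[of 0] n_ge_3 lp by (subst hd_conv_nth) auto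
  have "seq_mor T \<alpha> \<beta> \<phi>"
    unfolding seq_mor_def a(1)
  proof (intro conjI allI impI)
    show "length \<beta> = n" "length \<phi> = n" using b lp by auto
    show "SuspA T (hd \<phi>) \<cdot> last \<alpha> = last \<beta> \<cdot> last \<phi>" using hp eq by (simp add: \<phi>_def)
  next
    fix k assume k: "k < n"
    show "\<phi> ! k \<in> Hom T (seq_obj T \<alpha> k) (seq_obj T \<beta> k)"
    proof (cases "Suc k < n")
      case True
      then show ?thesis using pk[OF True] seq_mor_nth_hom[OF chi(1), of "Suc k"] aa(1)
        a'(2)[rule_format, OF True] b'(2)[rule_format, OF True] by (simp add: seq_obj_def)
    next
      case False
      then have "k = n - 1" using k by simp
      then show ?thesis using pl g by simp
    qed
  next
    fix k assume k: "Suc k < n"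
    show "\<phi> ! Suc k \<cdot> \<alpha> ! k = \<beta> ! k \<cdot> \<phi> ! k"
    proof (cases "Suc (Suc k) < n")
      case True
      then have "\<chi> ! Suc (Suc k) \<cdot> \<alpha>' ! Suc k = \<beta>' ! Suc k \<cdot> \<chi> ! Suc k"
        using chi(1) aa(1) by (simp add: seq_mor_def)
      then show ?thesis
        using pk[OF k] pk[OF True] a'(2)[rule_format, OF k] b'(2)[rule_format, OF k] by simp
    next
      \<comment> \<open>The square at \<open>k = n - 2\<close> comes from the closing square of
        \<open>\<chi>\<close>, in which \<open>h\<close> occurs suspended, that is, as
        \<open>g\<close>.\<close>
      case False
      then have kk: "Suc k = n - 1" "k = n - 2" using k by auto
      have "hd \<chi> = h" "last \<chi> = \<chi> ! Suc k" using chi(2) ne len kk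
        by (simp_all add: hd_conv_nth last_conv_nth)
      then have "SuspA T h \<cdot> last \<alpha>' = last \<beta>' \<cdot> \<chi> ! Suc k"
        using chi(1) by (simp add: seq_mor_def)
      then show ?thesis
        using h(2) a'(3) b'(3) a(5) b(5) pl pk[OF k] kk by simp
    qed
  qed
  then show thesis using that hp by (simp add: \<phi>_def)
qed

section \<open>Exactness of angles\<close>

text \<open>For \<open>n = 3\<close> the replicated block is empty and position 2 is already the
  closing morphism, whence the case distinction.\<close>

lemma trivial_seq_nth:
  "length (trivial_seq T n Z X) = n" "hd (trivial_seq T n Z X) = Id T X"
  "trivial_seq T n Z X ! 0 = Id T X" "trivial_seq T n Z X ! Suc 0 = Zero T X Z"
  "last (trivial_seq T n Z X) = Zero T Z (SuspO T X)"
  "tl (trivial_seq T n Z X) ! 0 = Zero T X Z"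
  "trivial_seq T n Z X ! 2 = Zero T Z (if n = 3 then SuspO T X else Z)"
  "trivial_seq T n Z X ! (n - 1) = Zero T Z (SuspO T X)"
  using n_ge_3 by (auto simp: trivial_seq_def nth_append nth_Cons')

lemma trivial_seq_obj:
  assumes "X \<in> Obj T" "zero_object T Z"
  shows "seq_obj T (trivial_seq T n Z X) 0 = X" "seq_obj T (trivial_seq T n Z X) 1 = X"
    "seq_obj T (trivial_seq T n Z X) 2 = Z" "seq_obj T (trivial_seq T n Z X) (n - 1) = Z"
proof -
  have Z: "Z \<in> Obj T" using assms by (simp add: zero_object_def)
  show "seq_obj T (trivial_seq T n Z X) 0 = X" "seq_obj T (trivial_seq T n Z X) 1 = X"
    "seq_obj T (trivial_seq T n Z X) 2 = Z" "seq_obj T (trivial_seq T n Z X) (n - 1) = Z"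
    using trivial_seq_nth(3,4,7,8)[of Z X] Hom_Dom[OF id_hom] Hom_Dom[OF Zero_hom] Z assms(1) SuspO_obj
    by (simp_all add: seq_obj_def)
qed

text \<open>By \<open>F3\<close> the trivial angle on \<open>A\<^sub>1\<close> maps to
  \<open>\<alpha>\<close> with first components \<open>1\<close> and
  \<open>\<alpha>\<^sub>1\<close>. The second square then writes the composite as a morphism through
  the zero object.\<close>

lemma angle_comp_eq_Zero:
  assumes "\<alpha> \<in> Angles T"
  shows "\<alpha> ! 1 \<cdot> \<alpha> ! 0 = Zero T (seq_obj T \<alpha> 0) (seq_obj T \<alpha> 2)"
proof -
  note a = angle_homs[OF assms]
  obtain Z where Z: "zero_object T Z" using ex_zero_object by blast
  then have ZO: "Z \<in> Obj T" by (simp add: zero_object_def)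
  let ?X = "seq_obj T \<alpha> 0"
  let ?t = "trivial_seq T n Z ?X"
  note t = trivial_seq_obj[OF a(11) Z]
  obtain \<phi> where phi: "seq_mor T ?t \<alpha> \<phi>" "\<phi> ! 0 = Id T ?X" "\<phi> ! 1 = hd \<alpha>"
    using F3[OF F1_trivial[OF a(11) Z] assms, of "Id T ?X" "hd \<alpha>"] t id_hom[OF a(11)] a(3,6)
      comp_id_right[OF a(6)] by (auto simp: trivial_seq_nth)
  have "\<phi> ! 2 \<cdot> ?t ! 1 = \<alpha> ! 1 \<cdot> \<phi> ! 1"
    using phi(1) n_ge_3 by (auto simp: seq_mor_def trivial_seq_nth(1) numeral_2_eq_2)
  moreover have "\<phi> ! 2 \<in> Hom T Z (seq_obj T \<alpha> 2)"
    using seq_mor_nth_hom[OF phi(1), of 2] n_ge_3 t(3) by (simp add: trivial_seq_nth(1))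
  ultimately show ?thesis using comp_Zero a(3,11) phi(3) by (simp add: trivial_seq_nth)
qed

text \<open>In the inverse rotation the desuspended \<open>\<alpha>\<^sub>n\<close> and
  \<open>\<alpha>\<^sub>1\<close> are the first two morphisms, so \<open>angle_comp_eq_Zero\<close>
  applies up to sign.\<close>

lemma SuspA_hd_comp_last:
  assumes "\<alpha> \<in> Angles T"
  shows "SuspA T (hd \<alpha>) \<cdot> last \<alpha> = Zero T (seq_obj T \<alpha> (n - 1)) (SuspO T (seq_obj T \<alpha> 1))"
proof -
  note a = angle_homs[OF assms]
  obtain \<beta> where b: "\<beta> \<in> Angles T" "\<forall>k. Suc k < n \<longrightarrow> \<beta> ! Suc k = \<alpha> ! k"
    "last \<beta> = last (butlast \<alpha>)" "SuspA T (hd \<beta>) = rot_sign (last \<alpha>)"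
    "SuspO T (seq_obj T \<beta> 0) = seq_obj T \<alpha> (n - 1)" "seq_obj T \<beta> 1 = seq_obj T \<alpha> 0"
    "hd \<beta> \<in> Hom T (seq_obj T \<beta> 0) (seq_obj T \<alpha> 0)"
    by (rule inverse_rotation[OF assms])
  note bb = angle_homs[OF b(1)]
  have "\<beta> ! 1 = hd \<alpha>" "seq_obj T \<beta> 2 = seq_obj T \<alpha> 1"
    using b(2)[rule_format, of 0] b(2)[rule_format, of 1] n_ge_3 a(3) by (auto simp: seq_obj_def numeral_2_eq_2)
  then have "hd \<alpha> \<cdot> hd \<beta> = Zero T (seq_obj T \<beta> 0) (seq_obj T \<alpha> 1)"
    using angle_comp_eq_Zero[OF b(1)] bb(3) by simp
  then have "SuspA T (hd \<alpha>) \<cdot> SuspA T (hd \<beta>) =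
      Zero T (seq_obj T \<alpha> (n - 1)) (SuspO T (seq_obj T \<alpha> 1))"
    using susp_comp[OF b(7) a(6)] SuspA_Zero bb(11) Hom_Obj(2)[OF a(6)] b(5) by simp
  \<comment> \<open>The sign is removed by applying it again: \<open>rot_sign\<close> is an
    involution fixing zero.\<close>
  then have "rot_sign (SuspA T (hd \<alpha>) \<cdot> last \<alpha>) =
      Zero T (seq_obj T \<alpha> (n - 1)) (SuspO T (seq_obj T \<alpha> 1))"
    using b(4) comp_rot_sign[OF a(8) susp_hom[OF a(6)]] by simp
  then show ?thesis
    using rot_sign_rot_sign[OF comp_hom[OF a(8) susp_hom[OF a(6)]]]
      rot_sign_Zero[OF a(12) SuspO_obj[OF Hom_Obj(2)[OF a(6)]]] by simp
qed

text \<open>This is \<open>SuspA_hd_comp_last\<close> for the inverse rotation, which ends in the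
  deflation of \<open>\<alpha>\<close> and whose suspended first morphism is
  \<open>\<alpha>\<^sub>n\<close> up to sign.\<close>

lemma last_comp_last_butlast:
  assumes "\<alpha> \<in> Angles T"
  shows "last \<alpha> \<cdot> last (butlast \<alpha>) = Zero T (seq_obj T \<alpha> (n - 2)) (SuspO T (seq_obj T \<alpha> 0))"
proof -
  note a = angle_homs[OF assms]
  obtain \<beta> where b: "\<beta> \<in> Angles T" "\<forall>k. Suc k < n \<longrightarrow> \<beta> ! Suc k = \<alpha> ! k"
    "last \<beta> = last (butlast \<alpha>)" "SuspA T (hd \<beta>) = rot_sign (last \<alpha>)"
    "SuspO T (seq_obj T \<beta> 0) = seq_obj T \<alpha> (n - 1)" "seq_obj T \<beta> 1 = seq_obj T \<alpha> 0"
    "hd \<beta> \<in> Hom T (seq_obj T \<beta> 0) (seq_obj T \<alpha> 0)"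
    by (rule inverse_rotation[OF assms])
  note bb = angle_homs[OF b(1)]
  have o: "seq_obj T \<beta> (n - 1) = seq_obj T \<alpha> (n - 2)"
    using bb(10) b(3) Hom_Dom[OF a(7)] by simp
  have "rot_sign (last \<alpha> \<cdot> last (butlast \<alpha>)) = SuspA T (hd \<beta>) \<cdot> last \<beta>"
    using b(3,4) rot_sign_comp[OF a(7) a(8)] by simp
  also have "\<dots> = Zero T (seq_obj T \<alpha> (n - 2)) (SuspO T (seq_obj T \<alpha> 0))"
    using SuspA_hd_comp_last[OF b(1)] o b(6) by simp
  finally show ?thesis
    using rot_sign_rot_sign[OF comp_hom[OF a(7) a(8)]]
      rot_sign_Zero[OF Hom_Obj(1)[OF a(7)] SuspO_obj[OF a(11)]] by simp
qed

text \<open>Desuspend \<open>f\<close> to \<open>g\<close>, so that \<open>\<alpha>\<^sub>1\<close>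
  kills \<open>g\<close>. The rotated trivial angle, which starts with a morphism from
  \<open>Y\<close> to zero and ends with a signed identity of \<open>X\<close>, maps to
  \<open>\<alpha>\<close> with first components \<open>g\<close> and \<open>0\<close>. Its closing
  square factors \<open>f\<close> through \<open>\<alpha>\<^sub>n\<close> up to sign.\<close>

lemma last_weak_kernel:
  assumes "\<alpha> \<in> Angles T" "f \<in> Hom T X (SuspO T (seq_obj T \<alpha> 0))"
    and "SuspA T (hd \<alpha>) \<cdot> f = Zero T X (SuspO T (seq_obj T \<alpha> 1))"
  obtains h where "h \<in> Hom T X (seq_obj T \<alpha> (n - 1))" "f = last \<alpha> \<cdot> h"
proof -
  note a = angle_homs[OF assms(1)]
  obtain Y where Y: "Y \<in> Obj T" "SuspO T Y = X" using SuspO_surj Hom_Obj[OF assms(2)] by blast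
  obtain g where g: "g \<in> Hom T Y (seq_obj T \<alpha> 0)" "SuspA T g = f"
    using SuspA_full[OF _ Y(1) a(11)] assms(2) Y(2) by blast
  have hg: "hd \<alpha> \<cdot> g = Zero T Y (seq_obj T \<alpha> 1)"
    using SuspA_eq_ZeroD[OF _ comp_hom[OF g(1) a(6)]] susp_comp[OF g(1) a(6)] assms(3) g(2) Y(2)
    by simp
  obtain Z where Z: "zero_object T Z" using ex_zero_object by blast
  then have ZO: "Z \<in> Obj T" by (simp add: zero_object_def)
  let ?t = "trivial_seq T n Z Y"
  note t = trivial_seq_obj[OF Y(1) Z]
  let ?r = "rotate_seq T ?t"
  have tA: "?t \<in> Angles T" using F1_trivial[OF Y(1) Z] .
  have rA: "?r \<in> Angles T" using F2[OF angle_seq[OF tA]] tA by blast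
  note r = angle_homs[OF rA]
  have r0: "?r ! 0 = Zero T Y Z" "?r ! 1 = ?t ! 2"
    using n_ge_3 trivial_seq_nth(1,6)[of Z Y]
    by (auto simp: rotate_seq_def nth_append nth_tl numeral_2_eq_2)
  have rl: "last ?r = rot_sign (Id T X)"
    using trivial_seq_nth[of Z Y] susp_id[OF Y(1)] Y(2) by (simp add: rotate_seq_def rot_sign_def)
  have XO: "X \<in> Obj T" using SuspO_obj Y by blast
  have iX: "Id T X \<in> Hom T X X" using id_hom[OF XO] .
  have ro: "seq_obj T ?r 0 = Y" "seq_obj T ?r 1 = Z" "seq_obj T ?r (n - 1) = X"
    using r(10) r0 rl t(3) Hom_Dom[OF Zero_hom[OF Y(1) ZO]] Hom_Dom[OF rot_sign_hom[OF iX]]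
    by (simp_all add: seq_obj_def)
  have A1: "seq_obj T \<alpha> 1 \<in> Obj T" using Hom_Obj(2)[OF a(6)] .
  obtain \<phi> where phi: "seq_mor T ?r \<alpha> \<phi>" "\<phi> ! 0 = g"
    using F3[OF rA assms(1), of g "Zero T Z (seq_obj T \<alpha> 1)"] ro g(1) Zero_hom[OF ZO A1] r0(1)
      comp_Zero[OF Zero_hom[OF ZO A1] Y(1)] hg a(3) by auto
  have p: "hd \<phi> = g" "last \<phi> = \<phi> ! (n - 1)"
    using seq_mor_hd_last[OF phi(1) r(1)] phi(2) by simp_all
  have ph: "last \<phi> \<in> Hom T X (seq_obj T \<alpha> (n - 1))"
    using seq_mor_nth_hom[OF phi(1), of "n - 1"] r(1) n_ge_3 ro(3) p(2) by simp
  have "f \<cdot> rot_sign (Id T X) = last \<alpha> \<cdot> last \<phi>"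
    using phi(1) p(1) g(2) rl by (simp add: seq_mor_def)
  then have "rot_sign f = last \<alpha> \<cdot> last \<phi>"
    using comp_rot_sign[OF iX assms(2)] comp_id_right[OF assms(2)] by simp
  \<comment> \<open>The sign is absorbed into the factor \<open>h\<close>.\<close>
  then have "f = last \<alpha> \<cdot> rot_sign (last \<phi>)"
    using comp_rot_sign[OF ph a(8)] rot_sign_rot_sign[OF assms(2)] by simp
  then show thesis using that rot_sign_hom[OF ph] by blast
qed

text \<open>Exactness one place earlier is \<open>last_weak_kernel\<close> for the inverse
  rotation.\<close>

lemma last_butlast_weak_kernel:
  assumes "\<alpha> \<in> Angles T" "f \<in> Hom T X (seq_obj T \<alpha> (n - 1))"
    and "last \<alpha> \<cdot> f = Zero T X (SuspO T (seq_obj T \<alpha> 0))"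
  obtains h where "h \<in> Hom T X (seq_obj T \<alpha> (n - 2))" "f = last (butlast \<alpha>) \<cdot> h"
proof -
  note a = angle_homs[OF assms(1)]
  obtain \<beta> where b: "\<beta> \<in> Angles T" "\<forall>k. Suc k < n \<longrightarrow> \<beta> ! Suc k = \<alpha> ! k"
    "last \<beta> = last (butlast \<alpha>)" "SuspA T (hd \<beta>) = rot_sign (last \<alpha>)"
    "SuspO T (seq_obj T \<beta> 0) = seq_obj T \<alpha> (n - 1)" "seq_obj T \<beta> 1 = seq_obj T \<alpha> 0"
    "hd \<beta> \<in> Hom T (seq_obj T \<beta> 0) (seq_obj T \<alpha> 0)"
    by (rule inverse_rotation[OF assms(1)])
  note bb = angle_homs[OF b(1)]
  have o: "seq_obj T \<beta> (n - 1) = seq_obj T \<alpha> (n - 2)"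
    using bb(10) b(3) Hom_Dom[OF a(7)] by simp
  have "SuspA T (hd \<beta>) \<cdot> f = Zero T X (SuspO T (seq_obj T \<beta> 1))"
    using rot_sign_comp[OF assms(2) a(8)] assms(3) b(4,6) rot_sign_Zero SuspO_obj a(11)
      Hom_Obj(1)[OF assms(2)] by simp
  then show thesis using last_weak_kernel[OF b(1), of f X] that assms(2) b(3,5) o by metis
qed

text \<open>The hypothesis is exactly the closing square of a morphism from \<open>\<alpha>\<close>
  to the trivial angle on \<open>Y\<close> with first component \<open>g\<close> and last component
  zero. Its second component is \<open>h\<close>, and its first square is the required
  factorization.\<close>

lemma hd_weak_cokernel:
  assumes "\<alpha> \<in> Angles T" "g \<in> Hom T (seq_obj T \<alpha> 0) Y"
    and "SuspA T g \<cdot> last \<alpha> = Zero T (seq_obj T \<alpha> (n - 1)) (SuspO T Y)"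
  obtains h where "h \<in> Hom T (seq_obj T \<alpha> 1) Y" "g = h \<cdot> hd \<alpha>"
proof -
  note a = angle_homs[OF assms(1)]
  have YO: "Y \<in> Obj T" using Hom_Obj[OF assms(2)] by blast
  obtain Z where Z: "zero_object T Z" using ex_zero_object by blast
  then have ZO: "Z \<in> Obj T" by (simp add: zero_object_def)
  let ?t = "trivial_seq T n Z Y"
  note t = trivial_seq_obj[OF YO Z]
  have tA: "?t \<in> Angles T" using F1_trivial[OF YO Z] .
  have z: "Zero T (seq_obj T \<alpha> (n - 1)) Z \<in> Hom T (seq_obj T \<alpha> (n - 1)) Z"
    using Zero_hom[OF a(12) ZO] .
  obtain \<phi> where phi: "seq_mor T \<alpha> ?t \<phi>" "hd \<phi> = g"
    using ex_seq_mor_first_last[OF assms(1) tA, of g "Zero T (seq_obj T \<alpha> (n - 1)) Z"] t z assms(2,3)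
      Zero_comp[OF z SuspO_obj[OF YO]] by (auto simp: trivial_seq_nth)
  have "\<phi> ! 0 = g"
    using seq_mor_hd_last(1)[OF phi(1) a(1)] phi(2) by simp
  moreover have h: "\<phi> ! 1 \<in> Hom T (seq_obj T \<alpha> 1) Y"
    using seq_mor_nth_hom[OF phi(1), of 1] a(1) n_ge_3 t(2) by simp
  moreover have "\<phi> ! Suc 0 \<cdot> \<alpha> ! 0 = ?t ! 0 \<cdot> \<phi> ! 0"
    using phi(1) a(1) n_ge_3 unfolding seq_mor_def by auto
  ultimately have "g = \<phi> ! 1 \<cdot> hd \<alpha>"
    using comp_id_left[OF assms(2)] a(3) by (simp add: trivial_seq_nth)
  then show thesis using that h by blast
qed

text \<open>Apply \<open>hd_weak_cokernel\<close> to the inverse rotation and suspend. The sign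
  carried by \<open>\<alpha>\<^sub>n\<close> there is shifted onto \<open>h\<close>.\<close>

lemma last_weak_cokernel:
  assumes "\<alpha> \<in> Angles T" "f \<in> Hom T (seq_obj T \<alpha> (n - 1)) (SuspO T Y)" "Y \<in> Obj T"
    and "f \<cdot> last (butlast \<alpha>) = Zero T (seq_obj T \<alpha> (n - 2)) (SuspO T Y)"
  obtains h where "h \<in> Hom T (seq_obj T \<alpha> 0) Y" "f = SuspA T h \<cdot> last \<alpha>"
proof -
  note a = angle_homs[OF assms(1)]
  obtain \<beta> where b: "\<beta> \<in> Angles T" "\<forall>k. Suc k < n \<longrightarrow> \<beta> ! Suc k = \<alpha> ! k"
    "last \<beta> = last (butlast \<alpha>)" "SuspA T (hd \<beta>) = rot_sign (last \<alpha>)"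
    "SuspO T (seq_obj T \<beta> 0) = seq_obj T \<alpha> (n - 1)" "seq_obj T \<beta> 1 = seq_obj T \<alpha> 0"
    "hd \<beta> \<in> Hom T (seq_obj T \<beta> 0) (seq_obj T \<alpha> 0)"
    by (rule inverse_rotation[OF assms(1)])
  note bb = angle_homs[OF b(1)]
  have o: "seq_obj T \<beta> (n - 1) = seq_obj T \<alpha> (n - 2)"
    using bb(10) b(3) Hom_Dom[OF a(7)] by simp
  obtain g where g: "g \<in> Hom T (seq_obj T \<beta> 0) Y" "SuspA T g = f"
    using SuspA_full[OF _ bb(11) assms(3)] assms(2) b(5) by metis
  obtain h where h: "h \<in> Hom T (seq_obj T \<alpha> 0) Y" "g = h \<cdot> hd \<beta>"
    using hd_weak_cokernel[OF b(1) g(1)] assms(4) b(3,6) g(2) o by metis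
  have hb: "hd \<beta> \<in> Hom T (seq_obj T \<beta> 0) (seq_obj T \<alpha> 0)" using bb(6) b(6) by simp
  have "f = SuspA T h \<cdot> rot_sign (last \<alpha>)"
    using susp_comp[OF hb h(1)] g(2) h(2) b(4) by simp
  also have "\<dots> = SuspA T (rot_sign h) \<cdot> last \<alpha>"
    using comp_rot_sign[OF a(8) susp_hom[OF h(1)]] rot_sign_comp[OF a(8) susp_hom[OF h(1)]]
      SuspA_rot_sign[OF h(1)] by simp
  finally show thesis using that rot_sign_hom[OF h(1)] by blast
qed

end

section \<open>Phantoms and ideals\<close>

locale almost_n_exact_category = n_angulated_category n T
  for n :: nat and T :: "('o, 'm, 'z) angulated_data_scheme" (structure) +
  fixes A :: "'o set" and E :: "'m list set"
  assumes sub_obj: "A \<subseteq> Obj T"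
    and extensions: "extension_closed T A"
    and exact: "almost_n_exact_structure T A E"
begin

lemma exact_subset: "E \<subseteq> sub_angles T A"
  using exact unfolding almost_n_exact_structure_def by (rule conjunct1)

lemma exact_angle: "\<alpha> \<in> E \<Longrightarrow> \<alpha> \<in> Angles T"
  using exact_subset by (auto simp: sub_angles_def)

lemma exact_angle_obj:
  assumes "\<alpha> \<in> E" "k < n" shows "seq_obj T \<alpha> k \<in> A"
proof -
  have "\<forall>f \<in> set \<alpha>. Dom T f \<in> A"
    using exact_subset assms(1) by (auto simp: sub_angles_def)
  then show ?thesis using angle_homs(1)[OF exact_angle[OF assms(1)]] assms(2)
    by (simp add: seq_obj_def)
qed

lemma angle_obj:
  assumes "\<alpha> \<in> Angles T" "seq_obj T \<alpha> 0 \<in> A" "seq_obj T \<alpha> (n - 1) \<in> A" "k < n"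
  shows "seq_obj T \<alpha> k \<in> A"
proof -
  have "\<forall>f \<in> set \<alpha>. Dom T f \<in> A"
    using extensions assms(1) assms(2,3)[unfolded angle_homs(9,10)[OF assms(1)]]
    unfolding extension_closed_def by blast
  then show ?thesis using angle_homs(1)[OF assms(1)] assms(4)
    by (simp add: seq_obj_def)
qed

section \<open>Base and cobase change of exact angles, and phantoms\<close>

lemma sub_arrI: "\<lbrakk>f \<in> Hom T X Y; X \<in> A; Y \<in> A\<rbrakk> \<Longrightarrow> f \<in> sub_arr T A"
  by (simp add: sub_arr_def Hom_def)

lemma sub_arrD:
  assumes "f \<in> sub_arr T A"
  shows "f \<in> Hom T (Dom T f) (Cod T f)" "Dom T f \<in> A" "Cod T f \<in> A"
  using assms by (simp_all add: sub_arr_def Hom_def)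

lemma sub_arr_HomD: "\<lbrakk>f \<in> sub_arr T A; f \<in> Hom T X Y\<rbrakk> \<Longrightarrow> X \<in> A \<and> Y \<in> A"
  by (auto simp: sub_arr_def Hom_def)

text \<open>\<open>N2\<close> asks for a morphism of angles with identity and \<open>f\<close> at
  the two ends; \<open>ex_seq_mor_first_last\<close> always supplies it. Hence every angle with the
  prescribed last morphism and first object is exact.\<close>

lemma pullback_exact:
  assumes "\<alpha> \<in> E" "f \<in> Hom T W (seq_obj T \<alpha> (n - 1))" "W \<in> A"
    and "\<beta> \<in> Angles T" "seq_obj T \<beta> 0 = seq_obj T \<alpha> 0" "last \<beta> = last \<alpha> \<cdot> f"
  shows "\<beta> \<in> E"
proof -
  have a': "\<alpha> \<in> Angles T" using exact_angle[OF assms(1)] .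
  note a = angle_homs[OF a'] and b = angle_homs[OF assms(4)]
  let ?i = "Id T (seq_obj T \<alpha> 0)"
  have bl: "last \<beta> \<in> Hom T W (SuspO T (seq_obj T \<alpha> 0))"
    using comp_hom[OF assms(2) a(8)] assms(6) by simp
  have bo: "seq_obj T \<beta> (n - 1) = W" using Hom_Dom[OF bl] b(10) by simp
  have i: "?i \<in> Hom T (seq_obj T \<beta> 0) (seq_obj T \<alpha> 0)" using id_hom[OF a(11)] assms(5) by simp
  have f: "f \<in> Hom T (seq_obj T \<beta> (n - 1)) (seq_obj T \<alpha> (n - 1))" using assms(2) bo by simp
  \<comment> \<open>With an identity at the first object, the closing square is the prescribed
    formula for \<open>last \<beta>\<close>.\<close>
  have eq: "last \<alpha> \<cdot> f = SuspA T ?i \<cdot> last \<beta>"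
    using susp_id[OF a(11)] comp_id_left[OF bl] assms(6) by simp
  obtain \<phi> where phi: "seq_mor T \<beta> \<alpha> \<phi>" "hd \<phi> = ?i" "last \<phi> = f"
    by (rule ex_seq_mor_first_last[OF assms(4) a' i f eq])
  have fs: "f \<in> sub_arr T A"
    using sub_arrI[OF assms(2,3)] exact_angle_obj[OF assms(1)] n_ge_3 by simp
  have N2: "\<forall>\<alpha> \<in> E. \<forall>f \<in> sub_arr T A. Cod T f = Dom T (last \<alpha>) \<longrightarrow>
        (\<forall>\<beta> \<in> Angles T.
           Dom T (hd \<beta>) = Dom T (hd \<alpha>) \<and> Dom T (last \<beta>) = Dom T f \<and>
           last \<beta> = last \<alpha> \<cdot> f \<and>
           (\<exists>\<phi>. seq_mor T \<beta> \<alpha> \<phi> \<and> hd \<phi> = Id T (Dom T (hd \<alpha>)) \<and> last \<phi> = f)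
           \<longrightarrow> \<beta> \<in> E)"
    using exact unfolding almost_n_exact_structure_def by (elim conjE)
  have "Cod T f = Dom T (last \<alpha>)" using Hom_Cod[OF assms(2)] a(10) by simp
  moreover have "Dom T (hd \<beta>) = Dom T (hd \<alpha>)" using assms(5) a(9) b(9) by simp
  moreover have "Dom T (last \<beta>) = Dom T f" using Hom_Dom[OF bl] Hom_Dom[OF assms(2)] by simp
  moreover have "hd \<phi> = Id T (Dom T (hd \<alpha>))" using phi(2) a(9) by simp
  ultimately show ?thesis using N2 assms(1,4,6) fs phi(1,3) by blast
qed

text \<open>The same for \<open>N3\<close>, with \<open>g\<close> at the first object and an
  identity at the last.\<close>

lemma pushout_exact:
  assumes "\<alpha> \<in> E" "g \<in> Hom T (seq_obj T \<alpha> 0) V" "V \<in> A"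
    and "\<beta> \<in> Angles T" "seq_obj T \<beta> 0 = V" "last \<beta> = SuspA T g \<cdot> last \<alpha>"
  shows "\<beta> \<in> E"
proof -
  have a': "\<alpha> \<in> Angles T" using exact_angle[OF assms(1)] .
  note a = angle_homs[OF a'] and b = angle_homs[OF assms(4)]
  let ?i = "Id T (seq_obj T \<alpha> (n - 1))"
  have bl: "last \<beta> \<in> Hom T (seq_obj T \<alpha> (n - 1)) (SuspO T V)"
    using comp_hom[OF a(8) susp_hom[OF assms(2)]] assms(6) by simp
  have bo: "seq_obj T \<beta> (n - 1) = seq_obj T \<alpha> (n - 1)" using Hom_Dom[OF bl] b(10) by simp
  have i: "?i \<in> Hom T (seq_obj T \<alpha> (n - 1)) (seq_obj T \<beta> (n - 1))" using id_hom[OF a(12)] bo by simp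
  have g: "g \<in> Hom T (seq_obj T \<alpha> 0) (seq_obj T \<beta> 0)" using assms(2,5) by simp
  have eq: "last \<beta> \<cdot> ?i = SuspA T g \<cdot> last \<alpha>"
    using comp_id_right[OF bl] assms(6) by simp
  obtain \<phi> where phi: "seq_mor T \<alpha> \<beta> \<phi>" "hd \<phi> = g" "last \<phi> = ?i"
    by (rule ex_seq_mor_first_last[OF a' assms(4) g i eq])
  have gs: "g \<in> sub_arr T A"
    using sub_arrI[OF assms(2) _ assms(3)] exact_angle_obj[OF assms(1)] n_ge_3 by simp
  have N3: "\<forall>\<alpha> \<in> E. \<forall>g \<in> sub_arr T A. Dom T g = Dom T (hd \<alpha>) \<longrightarrow>
        (\<forall>\<beta> \<in> Angles T.
           Dom T (hd \<beta>) = Cod T g \<and> Dom T (last \<beta>) = Dom T (last \<alpha>) \<and>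
           last \<beta> = SuspA T g \<cdot> last \<alpha> \<and>
           (\<exists>\<phi>. seq_mor T \<alpha> \<beta> \<phi> \<and> hd \<phi> = g \<and> last \<phi> = Id T (Dom T (last \<alpha>)))
           \<longrightarrow> \<beta> \<in> E)"
    using exact unfolding almost_n_exact_structure_def by (elim conjE)
  have "Dom T g = Dom T (hd \<alpha>)" using Hom_Dom[OF assms(2)] a(9) by simp
  moreover have "Dom T (hd \<beta>) = Cod T g" using Hom_Cod[OF g] b(9) by simp
  moreover have "Dom T (last \<beta>) = Dom T (last \<alpha>)" using bo a(10) b(10) by simp
  moreover have "last \<phi> = Id T (Dom T (last \<alpha>))" using phi(3) a(10) by simp
  ultimately show ?thesis using N3 assms(1,4,6) gs phi(1,2) by blast
qed

text \<open>As a morphism, a phantom shows only the suspension of the first object of its angle;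
  injectivity of \<open>SuspO\<close> recovers that object.\<close>

lemma phantom_angle:
  assumes "\<theta> \<in> phantoms E" "\<theta> \<in> Hom T Z (SuspO T B)" "B \<in> Obj T"
  obtains \<alpha> where "\<alpha> \<in> E" "\<alpha> \<in> Angles T" "last \<alpha> = \<theta>" "seq_obj T \<alpha> 0 = B" "seq_obj T \<alpha> (n - 1) = Z"
proof -
  obtain \<alpha> where a: "\<alpha> \<in> E" "last \<alpha> = \<theta>" using assms(1) by (auto simp: phantoms_def)
  note h = angle_homs[OF exact_angle[OF a(1)]]
  have "seq_obj T \<alpha> (n - 1) = Z" using h(10) Hom_Dom[OF assms(2)] a(2) by simp
  moreover have "seq_obj T \<alpha> 0 = B"
    using SuspO_inj[OF _ h(11) assms(3)] Hom_Cod[OF h(8)] Hom_Cod[OF assms(2)] a(2) by simp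
  ultimately show thesis using that a exact_angle by blast
qed

text \<open>Complete the composite to an angle with that last morphism;
  \<open>pullback_exact\<close> places it in \<open>E\<close>.\<close>

lemma phantom_comp:
  assumes "\<theta> \<in> phantoms E" "\<theta> \<in> Hom T Z (SuspO T B)" "B \<in> Obj T" "f \<in> Hom T W Z" "W \<in> A"
  shows "\<theta> \<cdot> f \<in> phantoms E"
proof -
  obtain \<alpha> where a: "\<alpha> \<in> E" "\<alpha> \<in> Angles T" "last \<alpha> = \<theta>" "seq_obj T \<alpha> 0 = B" "seq_obj T \<alpha> (n - 1) = Z"
    by (rule phantom_angle[OF assms(1,2,3)])
  obtain \<beta> where b: "\<beta> \<in> Angles T" "last \<beta> = \<theta> \<cdot> f" "seq_obj T \<beta> 0 = B" "seq_obj T \<beta> (n - 1) = W"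
    by (rule ex_angle_last[OF comp_hom[OF assms(4,2)] assms(3)])
  have "\<beta> \<in> E" using pullback_exact[OF a(1), of f W \<beta>] assms(4,5) a b by simp
  then show ?thesis using imageI[of \<beta> E last] b(2) by (simp add: phantoms_def)
qed

lemma susp_comp_phantom:
  assumes "\<theta> \<in> phantoms E" "\<theta> \<in> Hom T Z (SuspO T B)" "g \<in> Hom T B V" "V \<in> A"
  shows "SuspA T g \<cdot> \<theta> \<in> phantoms E"
proof -
  obtain \<alpha> where a: "\<alpha> \<in> E" "\<alpha> \<in> Angles T" "last \<alpha> = \<theta>" "seq_obj T \<alpha> 0 = B" "seq_obj T \<alpha> (n - 1) = Z"
    by (rule phantom_angle[OF assms(1,2) Hom_Obj(1)[OF assms(3)]])
  obtain \<beta> where b: "\<beta> \<in> Angles T" "last \<beta> = SuspA T g \<cdot> \<theta>" "seq_obj T \<beta> 0 = V" "seq_obj T \<beta> (n - 1) = Z"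
    by (rule ex_angle_last[OF comp_hom[OF assms(2) susp_hom[OF assms(3)]] Hom_Obj(2)[OF assms(3)]])
  have "\<beta> \<in> E" using pushout_exact[OF a(1), of g V \<beta>] assms(3,4) a b by simp
  then show ?thesis using imageI[of \<beta> E last] b(2) by (simp add: phantoms_def)
qed

section \<open>Orthogonality and composition\<close>

lemma perpD:
  assumes "perp T E f g" "f \<in> Hom T X Z" "g \<in> Hom T B Y"
    and "\<theta> \<in> phantoms E" "\<theta> \<in> Hom T Z (SuspO T B)"
  shows "SuspA T g \<cdot> (\<theta> \<cdot> f) = Zero T X (SuspO T Y)"
  using assms(1,4,5)
  unfolding perp_def Hom_Dom[OF assms(2)] Hom_Cod[OF assms(2)] Hom_Dom[OF assms(3)] Hom_Cod[OF assms(3)]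
  by blast

lemma perpI:
  assumes "f \<in> Hom T X Z" "g \<in> Hom T B Y"
    and "\<And>\<theta>. \<lbrakk>\<theta> \<in> phantoms E; \<theta> \<in> Hom T Z (SuspO T B)\<rbrakk> \<Longrightarrow> SuspA T g \<cdot> (\<theta> \<cdot> f) = Zero T X (SuspO T Y)"
  shows "perp T E f g"
  using assms(3)
  unfolding perp_def Hom_Dom[OF assms(1)] Hom_Cod[OF assms(1)] Hom_Dom[OF assms(2)] Hom_Cod[OF assms(2)]
  by blast

text \<open>Suspending \<open>a\<close> and composing it with the phantom \<open>\<theta>\<close>
  gives a phantom again, because \<open>B\<close> lies in \<open>A\<close>. The given orthogonality
  kills the regrouped inner composite.\<close>

lemma perp_comp_right:
  assumes "perp T E f g" "f \<in> Hom T X Z" "g \<in> Hom T B Y" "a \<in> Hom T B' B" "b \<in> Hom T Y Y'" "B \<in> A"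
  shows "perp T E f (b \<cdot> (g \<cdot> a))"
proof (rule perpI[OF assms(2)])
  have ga: "g \<cdot> a \<in> Hom T B' Y" using comp_hom[OF assms(4,3)] .
  show "b \<cdot> (g \<cdot> a) \<in> Hom T B' Y'" using comp_hom[OF ga assms(5)] .
  fix \<theta> assume t: "\<theta> \<in> phantoms E" "\<theta> \<in> Hom T Z (SuspO T B')"
  note sa = susp_hom[OF assms(4)] and sg = susp_hom[OF assms(3)] and sb = susp_hom[OF assms(5)]
  note tf = comp_hom[OF assms(2) t(2)] and st = comp_hom[OF t(2) sa]
  have "SuspA T (b \<cdot> (g \<cdot> a)) \<cdot> (\<theta> \<cdot> f) =
      SuspA T b \<cdot> (SuspA T g \<cdot> ((SuspA T a \<cdot> \<theta>) \<cdot> f))"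
    using susp_comp[OF ga assms(5)] susp_comp[OF assms(4,3)]
      comp_assoc[OF tf comp_hom[OF sa sg] sb] comp_assoc[OF tf sa sg]
      comp_assoc[OF assms(2) t(2) sa] by simp
  also have "SuspA T g \<cdot> ((SuspA T a \<cdot> \<theta>) \<cdot> f) = Zero T X (SuspO T Y)"
    using perpD[OF assms(1-3) susp_comp_phantom[OF t assms(4,6)] st] .
  also have "SuspA T b \<cdot> Zero T X (SuspO T Y) = Zero T X (SuspO T Y')"
    using comp_Zero[OF sb Hom_Obj(1)[OF assms(2)]] .
  finally show "SuspA T (b \<cdot> (g \<cdot> a)) \<cdot> (\<theta> \<cdot> f) = Zero T X (SuspO T Y')" .
qed

text \<open>Here \<open>\<theta> \<cdot> b\<close> is again a phantom, because \<open>Z\<close> lies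
  in \<open>A\<close>.\<close>

lemma perp_comp_left:
  assumes "perp T E f g" "f \<in> Hom T X Z" "g \<in> Hom T B Y" "a \<in> Hom T X' X" "b \<in> Hom T Z Z'" "Z \<in> A"
  shows "perp T E (b \<cdot> (f \<cdot> a)) g"
proof (rule perpI[OF _ assms(3)])
  have fa: "f \<cdot> a \<in> Hom T X' Z" using comp_hom[OF assms(4,2)] .
  show "b \<cdot> (f \<cdot> a) \<in> Hom T X' Z'" using comp_hom[OF fa assms(5)] .
  fix \<theta> assume t: "\<theta> \<in> phantoms E" "\<theta> \<in> Hom T Z' (SuspO T B)"
  note sg = susp_hom[OF assms(3)]
  note tb = comp_hom[OF assms(5) t(2)]
  have "SuspA T g \<cdot> (\<theta> \<cdot> (b \<cdot> (f \<cdot> a))) = (SuspA T g \<cdot> ((\<theta> \<cdot> b) \<cdot> f)) \<cdot> a"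
    using comp_assoc[OF fa assms(5) t(2)] comp_assoc[OF assms(4,2) tb]
      comp_assoc[OF assms(4) comp_hom[OF assms(2) tb] sg] by simp
  also have "SuspA T g \<cdot> ((\<theta> \<cdot> b) \<cdot> f) = Zero T X (SuspO T Y)"
    using perpD[OF assms(1-3) phantom_comp[OF t Hom_Obj(1)[OF assms(3)] assms(5,6)] tb] .
  also have "Zero T X (SuspO T Y) \<cdot> a = Zero T X' (SuspO T Y)"
    using Zero_comp[OF assms(4)] SuspO_obj Hom_Obj(2)[OF assms(3)] by simp
  finally show "SuspA T g \<cdot> (\<theta> \<cdot> (b \<cdot> (f \<cdot> a))) = Zero T X' (SuspO T Y)" .
qed

section \<open>Ideals, and the ideal property of both orthogonals\<close>

lemma arr_idealI:
  assumes "M \<subseteq> sub_arr T A"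
    and "\<And>X Y. \<lbrakk>X \<in> A; Y \<in> A\<rbrakk> \<Longrightarrow> Zero T X Y \<in> M"
    and "\<And>X Y f g. \<lbrakk>f \<in> M; g \<in> M; f \<in> Hom T X Y; g \<in> Hom T X Y\<rbrakk> \<Longrightarrow> Add T f g \<in> M"
    and "\<And>X Y f. \<lbrakk>f \<in> M; f \<in> Hom T X Y\<rbrakk> \<Longrightarrow> Neg T f \<in> M"
    and "\<And>W X Y Z f a b. \<lbrakk>f \<in> M; f \<in> Hom T X Y; a \<in> Hom T W X; b \<in> Hom T Y Z; W \<in> A; Z \<in> A\<rbrakk>
      \<Longrightarrow> b \<cdot> (f \<cdot> a) \<in> M"
  shows "arr_ideal T A M"
  unfolding arr_ideal_def
proof (intro conjI ballI impI)
  show "M \<subseteq> sub_arr T A" by fact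
  fix X Y assume XY: "X \<in> A" "Y \<in> A"
  show "subgroup (M \<inter> Hom T X Y) (hom_group T X Y)"
  proof (rule subgroup.intro)
    show "M \<inter> Hom T X Y \<subseteq> carrier (hom_group T X Y)" by (simp add: hom_group_def)
    show "x \<otimes>\<^bsub>hom_group T X Y\<^esub> y \<in> M \<inter> Hom T X Y"
      if "x \<in> M \<inter> Hom T X Y" "y \<in> M \<inter> Hom T X Y" for x y
      using that assms(3) Add_hom by (auto simp: hom_group_def)
    show "\<one>\<^bsub>hom_group T X Y\<^esub> \<in> M \<inter> Hom T X Y"
      using assms(2)[OF XY] Zero_hom[of X Y] XY sub_obj by (auto simp: hom_group_def)
    show "inv\<^bsub>hom_group T X Y\<^esub> x \<in> M \<inter> Hom T X Y" if "x \<in> M \<inter> Hom T X Y" for x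
      using that assms(4)[of x X Y] Neg_hom[of x X Y] Neg_eq[of x X Y] by simp
  qed
next
  fix f a b
  assume f: "f \<in> M" and a: "a \<in> sub_arr T A" and b: "b \<in> sub_arr T A"
    and eq: "Cod T a = Dom T f \<and> Cod T f = Dom T b"
  have fs: "f \<in> sub_arr T A" using f assms(1) by blast
  show "b \<cdot> (f \<cdot> a) \<in> M"
    using assms(5)[OF f sub_arrD(1)[OF fs], of a "Dom T a" b "Cod T b"] eq
      sub_arrD[OF a] sub_arrD[OF b] by simp
qed

lemma arr_ideal_sub: "\<lbrakk>arr_ideal T A M; f \<in> M\<rbrakk> \<Longrightarrow> f \<in> sub_arr T A"
  unfolding arr_ideal_def by blast

text \<open>The definition of an ideal composes on both sides at once; an identity fills the other
  side.\<close>

lemma arr_ideal_comp_left: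
  assumes "arr_ideal T A M" "f \<in> M" "f \<in> Hom T X Y" "b \<in> Hom T Y Z" "Z \<in> A"
  shows "b \<cdot> f \<in> M"
proof -
  have XY: "X \<in> A" "Y \<in> A" using sub_arr_HomD[OF arr_ideal_sub[OF assms(1,2)] assms(3)] by auto
  have i: "Id T X \<in> Hom T X X" using id_hom XY sub_obj by blast
  have "b \<cdot> (f \<cdot> Id T X) \<in> M"
    using assms(1,2) sub_arrI[OF i XY(1) XY(1)] sub_arrI[OF assms(4) XY(2) assms(5)]
      Hom_Cod[OF i] Hom_Dom[OF assms(3)] Hom_Cod[OF assms(3)] Hom_Dom[OF assms(4)]
    by (auto simp: arr_ideal_def)
  then show ?thesis using comp_id_right[OF assms(3)] by simp
qed

lemma arr_ideal_comp_right:
  assumes "arr_ideal T A M" "f \<in> M" "f \<in> Hom T X Y" "a \<in> Hom T W X" "W \<in> A"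
  shows "f \<cdot> a \<in> M"
proof -
  have XY: "X \<in> A" "Y \<in> A" using sub_arr_HomD[OF arr_ideal_sub[OF assms(1,2)] assms(3)] by auto
  have i: "Id T Y \<in> Hom T Y Y" using id_hom XY sub_obj by blast
  have "Id T Y \<cdot> (f \<cdot> a) \<in> M"
    using assms(1,2) sub_arrI[OF i XY(2) XY(2)] sub_arrI[OF assms(4) assms(5) XY(1)]
      Hom_Dom[OF i] Hom_Dom[OF assms(3)] Hom_Cod[OF assms(3)] Hom_Cod[OF assms(4)]
    by (auto simp: arr_ideal_def)
  then show ?thesis using comp_id_left[OF comp_hom[OF assms(4,3)]] by simp
qed

text \<open>Orthogonality to a fixed \<open>m\<close> is a family of additive conditions on the
  other morphism, which gives the subgroup property. Two-sided closure is
  \<open>perp_comp_right\<close>.\<close>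

lemma right_perp_arr_ideal:
  assumes "M \<subseteq> sub_arr T A" shows "arr_ideal T A (right_perp T A E M)"
proof (rule arr_idealI)
  show "right_perp T A E M \<subseteq> sub_arr T A" by (auto simp: right_perp_def)
next
  fix X Y assume XY: "X \<in> A" "Y \<in> A"
  then have O: "X \<in> Obj T" "Y \<in> Obj T" using sub_obj by auto
  note z = Zero_hom[OF O]
  have "perp T E m (Zero T X Y)" if "m \<in> M" for m
  proof (rule perpI[OF _ z])
    show m: "m \<in> Hom T (Dom T m) (Cod T m)" using sub_arrD(1) assms that by blast
    fix \<theta> assume "\<theta> \<in> Hom T (Cod T m) (SuspO T X)"
    then show "SuspA T (Zero T X Y) \<cdot> (\<theta> \<cdot> m) = Zero T (Dom T m) (SuspO T Y)"
      using Zero_comp[OF comp_hom[OF m]] SuspA_Zero O SuspO_obj by simp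
  qed
  then show "Zero T X Y \<in> right_perp T A E M"
    using sub_arrI[OF z XY] by (simp add: right_perp_def)
next
  fix X Y f g
  assume fg: "f \<in> right_perp T A E M" "g \<in> right_perp T A E M" "f \<in> Hom T X Y" "g \<in> Hom T X Y"
  have XY: "X \<in> A" "Y \<in> A" using sub_arr_HomD[OF _ fg(3)] fg(1) by (auto simp: right_perp_def)
  have "perp T E m (Add T f g)" if "m \<in> M" for m
  proof (rule perpI[OF _ Add_hom[OF fg(3,4)]])
    show m: "m \<in> Hom T (Dom T m) (Cod T m)" using sub_arrD(1) assms that by blast
    fix \<theta> assume t: "\<theta> \<in> phantoms E" "\<theta> \<in> Hom T (Cod T m) (SuspO T X)"
    have "perp T E m f" "perp T E m g" using fg(1,2) that by (auto simp: right_perp_def)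
    then show "SuspA T (Add T f g) \<cdot> (\<theta> \<cdot> m) = Zero T (Dom T m) (SuspO T Y)"
      using perpD[OF _ m fg(3) t] perpD[OF _ m fg(4) t] susp_add[OF fg(3,4)]
        comp_add_left[OF comp_hom[OF m t(2)] susp_hom[OF fg(3)] susp_hom[OF fg(4)]]
        Add_Zero_Zero Hom_Obj(1)[OF m] SuspO_obj Hom_Obj(2)[OF fg(3)] by simp
  qed
  then show "Add T f g \<in> right_perp T A E M"
    using sub_arrI[OF Add_hom[OF fg(3,4)] XY] by (simp add: right_perp_def)
next
  fix X Y f
  assume f: "f \<in> right_perp T A E M" "f \<in> Hom T X Y"
  have XY: "X \<in> A" "Y \<in> A" using sub_arr_HomD[OF _ f(2)] f(1) by (auto simp: right_perp_def)
  have "perp T E m (Neg T f)" if "m \<in> M" for m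
  proof (rule perpI[OF _ Neg_hom[OF f(2)]])
    show m: "m \<in> Hom T (Dom T m) (Cod T m)" using sub_arrD(1) assms that by blast
    fix \<theta> assume t: "\<theta> \<in> phantoms E" "\<theta> \<in> Hom T (Cod T m) (SuspO T X)"
    have "perp T E m f" using f(1) that by (auto simp: right_perp_def)
    then show "SuspA T (Neg T f) \<cdot> (\<theta> \<cdot> m) = Zero T (Dom T m) (SuspO T Y)"
      using perpD[OF _ m f(2) t] SuspA_Neg[OF f(2)]
        Neg_comp[OF comp_hom[OF m t(2)] susp_hom[OF f(2)]]
        Neg_Zero Hom_Obj(1)[OF m] SuspO_obj Hom_Obj(2)[OF f(2)] by simp
  qed
  then show "Neg T f \<in> right_perp T A E M"
    using sub_arrI[OF Neg_hom[OF f(2)] XY] by (simp add: right_perp_def)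
next
  fix W X Y Z f a b
  assume f: "f \<in> right_perp T A E M" "f \<in> Hom T X Y"
    and ab: "a \<in> Hom T W X" "b \<in> Hom T Y Z" "W \<in> A" "Z \<in> A"
  have XY: "X \<in> A" using sub_arr_HomD[OF _ f(2)] f(1) by (auto simp: right_perp_def)
  have "perp T E m (b \<cdot> (f \<cdot> a))" if "m \<in> M" for m
  proof -
    have "m \<in> Hom T (Dom T m) (Cod T m)" using sub_arrD(1) assms that by blast
    moreover have "perp T E m f" using f(1) that by (auto simp: right_perp_def)
    ultimately show ?thesis using perp_comp_right f(2) ab(1,2) XY by blast
  qed
  then show "b \<cdot> (f \<cdot> a) \<in> right_perp T A E M"
    using sub_arrI[OF comp_hom[OF comp_hom[OF ab(1) f(2)] ab(2)] ab(3,4)] by (simp add: right_perp_def)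
qed

lemma left_perp_arr_ideal:
  assumes "M \<subseteq> sub_arr T A" shows "arr_ideal T A (left_perp T A E M)"
proof (rule arr_idealI)
  show "left_perp T A E M \<subseteq> sub_arr T A" by (auto simp: left_perp_def)
next
  fix X Y assume XY: "X \<in> A" "Y \<in> A"
  then have O: "X \<in> Obj T" "Y \<in> Obj T" using sub_obj by auto
  note z = Zero_hom[OF O]
  have "perp T E (Zero T X Y) m" if "m \<in> M" for m
  proof (rule perpI[OF z])
    show m: "m \<in> Hom T (Dom T m) (Cod T m)" using sub_arrD(1) assms that by blast
    fix \<theta> assume "\<theta> \<in> Hom T Y (SuspO T (Dom T m))"
    then show "SuspA T m \<cdot> (\<theta> \<cdot> Zero T X Y) = Zero T X (SuspO T (Cod T m))"
      using comp_Zero[OF _ O(1)] susp_hom[OF m] by simp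
  qed
  then show "Zero T X Y \<in> left_perp T A E M"
    using sub_arrI[OF z XY] by (simp add: left_perp_def)
next
  fix X Y f g
  assume fg: "f \<in> left_perp T A E M" "g \<in> left_perp T A E M" "f \<in> Hom T X Y" "g \<in> Hom T X Y"
  have XY: "X \<in> A" "Y \<in> A" using sub_arr_HomD[OF _ fg(3)] fg(1) by (auto simp: left_perp_def)
  have "perp T E (Add T f g) m" if "m \<in> M" for m
  proof (rule perpI[OF Add_hom[OF fg(3,4)]])
    show m: "m \<in> Hom T (Dom T m) (Cod T m)" using sub_arrD(1) assms that by blast
    fix \<theta> assume t: "\<theta> \<in> phantoms E" "\<theta> \<in> Hom T Y (SuspO T (Dom T m))"
    have "perp T E f m" "perp T E g m" using fg(1,2) that by (auto simp: left_perp_def)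
    then show "SuspA T m \<cdot> (\<theta> \<cdot> Add T f g) = Zero T X (SuspO T (Cod T m))"
      using perpD[OF _ fg(3) m t] perpD[OF _ fg(4) m t] comp_add_right[OF fg(3,4) t(2)]
        comp_add_right[OF comp_hom[OF fg(3) t(2)] comp_hom[OF fg(4) t(2)] susp_hom[OF m]]
        Add_Zero_Zero Hom_Obj(2)[OF m] SuspO_obj Hom_Obj(1)[OF fg(3)] by simp
  qed
  then show "Add T f g \<in> left_perp T A E M"
    using sub_arrI[OF Add_hom[OF fg(3,4)] XY] by (simp add: left_perp_def)
next
  fix X Y f
  assume f: "f \<in> left_perp T A E M" "f \<in> Hom T X Y"
  have XY: "X \<in> A" "Y \<in> A" using sub_arr_HomD[OF _ f(2)] f(1) by (auto simp: left_perp_def)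
  have "perp T E (Neg T f) m" if "m \<in> M" for m
  proof (rule perpI[OF Neg_hom[OF f(2)]])
    show m: "m \<in> Hom T (Dom T m) (Cod T m)" using sub_arrD(1) assms that by blast
    fix \<theta> assume t: "\<theta> \<in> phantoms E" "\<theta> \<in> Hom T Y (SuspO T (Dom T m))"
    have "perp T E f m" using f(1) that by (auto simp: left_perp_def)
    then show "SuspA T m \<cdot> (\<theta> \<cdot> Neg T f) = Zero T X (SuspO T (Cod T m))"
      using perpD[OF _ f(2) m t] comp_Neg[OF f(2) t(2)]
        comp_Neg[OF comp_hom[OF f(2) t(2)] susp_hom[OF m]]
        Neg_Zero Hom_Obj(2)[OF m] SuspO_obj Hom_Obj(1)[OF f(2)] by simp
  qed
  then show "Neg T f \<in> left_perp T A E M"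
    using sub_arrI[OF Neg_hom[OF f(2)] XY] by (simp add: left_perp_def)
next
  fix W X Y Z f a b
  assume f: "f \<in> left_perp T A E M" "f \<in> Hom T X Y"
    and ab: "a \<in> Hom T W X" "b \<in> Hom T Y Z" "W \<in> A" "Z \<in> A"
  have XY: "Y \<in> A" using sub_arr_HomD[OF _ f(2)] f(1) by (auto simp: left_perp_def)
  have "perp T E (b \<cdot> (f \<cdot> a)) m" if "m \<in> M" for m
  proof -
    have "m \<in> Hom T (Dom T m) (Cod T m)" using sub_arrD(1) assms that by blast
    moreover have "perp T E f m" using f(1) that by (auto simp: left_perp_def)
    ultimately show ?thesis using perp_comp_left f(2) ab(1,2) XY by blast
  qed
  then show "b \<cdot> (f \<cdot> a) \<in> left_perp T A E M"
    using sub_arrI[OF comp_hom[OF comp_hom[OF ab(1) f(2)] ab(2)] ab(3,4)] by (simp add: left_perp_def)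
qed

section \<open>Ideal cotorsion pairs\<close>

text \<open>The hypothesis on \<open>f\<close> is membership in the double orthogonal of
  \<open>M\<close>, phrased so that it serves two uses: elements of the left orthogonal of
  \<open>right_perp T A E M\<close>, and elements of \<open>M\<close> itself.\<close>

lemma special_precover_factors:
  assumes "special_precover T A E M X i" "f \<in> Hom T W X" "\<And>j. j \<in> right_perp T A E M \<Longrightarrow> perp T E f j"
  obtains k where "k \<in> Hom T W (Dom T i)" "f = i \<cdot> k"
proof -
  obtain \<alpha> j \<theta> where a: "\<alpha> \<in> Angles T" "last (butlast \<alpha>) = i"
    and j: "j \<in> right_perp T A E M" "Cod T j = Dom T (hd \<alpha>)"
    and t: "\<theta> \<in> phantoms E" "\<theta> \<in> Hom T X (SuspO T (Dom T j))" "last \<alpha> = SuspA T j \<cdot> \<theta>"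
    using assms(1) by (auto simp: special_precover_def)
  note h = angle_homs[OF a(1)]
  have jh: "j \<in> Hom T (Dom T j) (seq_obj T \<alpha> 0)"
    using j sub_arrD(1)[of j] h(9) by (auto simp: right_perp_def)
  note tj = comp_hom[OF t(2) susp_hom[OF jh]]
  have X: "seq_obj T \<alpha> (n - 1) = X" using h(10) t(3) Hom_Dom[OF tj] by simp
  have "last \<alpha> \<cdot> f = Zero T W (SuspO T (seq_obj T \<alpha> 0))"
    using perpD[OF assms(3)[OF j(1)] assms(2) jh t(1,2)] t(3)
      comp_assoc[OF assms(2) t(2) susp_hom[OF jh]] by simp
  then obtain k where "k \<in> Hom T W (seq_obj T \<alpha> (n - 2))" "f = last (butlast \<alpha>) \<cdot> k"
    using last_butlast_weak_kernel[OF a(1)] assms(2) X by metis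
  then show thesis using that a(2) Hom_Dom[OF h(7)] by simp
qed

text \<open>The dual: \<open>g\<close> suspended kills the last morphism of the angle of
  \<open>j\<close>, so \<open>g\<close> extends along \<open>j\<close> by
  \<open>hd_weak_cokernel\<close>.\<close>

lemma special_preenvelope_factors:
  assumes "special_preenvelope T A E M X j" "g \<in> Hom T X Y" "\<And>i. i \<in> left_perp T A E M \<Longrightarrow> perp T E i g"
  obtains k where "k \<in> Hom T (Cod T j) Y" "g = k \<cdot> j"
proof -
  obtain \<alpha> i \<theta> where a: "\<alpha> \<in> Angles T" "hd \<alpha> = j" and jX: "Dom T j = X"
    and i: "i \<in> left_perp T A E M" "Dom T i = Dom T (last \<alpha>)"
    and t: "\<theta> \<in> phantoms E" "\<theta> \<in> Hom T (Cod T i) (SuspO T X)" "last \<alpha> = \<theta> \<cdot> i"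
    using assms(1) by (auto simp: special_preenvelope_def)
  note h = angle_homs[OF a(1)]
  have ih: "i \<in> Hom T (seq_obj T \<alpha> (n - 1)) (Cod T i)"
    using i sub_arrD(1)[of i] h(10) by (auto simp: left_perp_def)
  have X: "seq_obj T \<alpha> 0 = X" using h(9) a(2) jX by simp
  have "SuspA T g \<cdot> last \<alpha> = Zero T (seq_obj T \<alpha> (n - 1)) (SuspO T Y)"
    using perpD[OF assms(3)[OF i(1)] ih assms(2) t(1,2)] t(3) by simp
  then obtain k where "k \<in> Hom T (seq_obj T \<alpha> 1) Y" "g = k \<cdot> hd \<alpha>"
    using hd_weak_cokernel[OF a(1), of g Y] assms(2) X by metis
  then show thesis using that a(2) Hom_Cod[OF h(6)] by simp
qed

lemma special_precovering_cotorsion_pair: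
  assumes I: "arr_ideal T A I" and "special_precovering T A E I"
  shows "ideal_cotorsion_pair T A E I (right_perp T A E I)"
proof -
  have "left_perp T A E (right_perp T A E I) \<subseteq> I"
  proof
    fix f assume f: "f \<in> left_perp T A E (right_perp T A E I)"
    then have fs: "f \<in> sub_arr T A" by (simp add: left_perp_def)
    obtain i where i: "special_precover T A E I (Cod T f) i"
      using assms(2) sub_arrD(3)[OF fs] by (auto simp: special_precovering_def)
    then have iI: "i \<in> I" "Cod T i = Cod T f" by (auto simp: special_precover_def)
    obtain k where k: "k \<in> Hom T (Dom T f) (Dom T i)" "f = i \<cdot> k"
      using special_precover_factors[OF i sub_arrD(1)[OF fs]] f by (auto simp: left_perp_def)
    show "f \<in> I"
      using arr_ideal_comp_right[OF I iI(1) sub_arrD(1)[OF arr_ideal_sub[OF I iI(1)]] k(1) sub_arrD(2)[OF fs]] k(2)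
      by simp
  qed
  \<comment> \<open>The formal half of the Galois connection between the two orthogonals.\<close>
  moreover have "I \<subseteq> left_perp T A E (right_perp T A E I)"
    using arr_ideal_sub[OF I] by (auto simp: left_perp_def right_perp_def)
  ultimately show ?thesis
    using I right_perp_arr_ideal[of I] arr_ideal_sub[OF I] by (auto simp: ideal_cotorsion_pair_def)
qed

lemma special_preenveloping_cotorsion_pair:
  assumes J: "arr_ideal T A J" and "special_preenveloping T A E J"
  shows "ideal_cotorsion_pair T A E (left_perp T A E J) J"
proof -
  have "right_perp T A E (left_perp T A E J) \<subseteq> J"
  proof
    fix g assume g: "g \<in> right_perp T A E (left_perp T A E J)"
    then have gs: "g \<in> sub_arr T A" by (simp add: right_perp_def)
    obtain j where j: "special_preenvelope T A E J (Dom T g) j"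
      using assms(2) sub_arrD(2)[OF gs] by (auto simp: special_preenveloping_def)
    then have jJ: "j \<in> J" "Dom T j = Dom T g" by (auto simp: special_preenvelope_def)
    obtain k where k: "k \<in> Hom T (Cod T j) (Cod T g)" "g = k \<cdot> j"
      using special_preenvelope_factors[OF j sub_arrD(1)[OF gs]] g by (auto simp: right_perp_def)
    show "g \<in> J"
      using arr_ideal_comp_left[OF J jJ(1) sub_arrD(1)[OF arr_ideal_sub[OF J jJ(1)]] k(1) sub_arrD(3)[OF gs]] k(2)
      by simp
  qed
  moreover have "J \<subseteq> right_perp T A E (left_perp T A E J)"
    using arr_ideal_sub[OF J] by (auto simp: left_perp_def right_perp_def)
  ultimately show ?thesis
    using J left_perp_arr_ideal[of J] arr_ideal_sub[OF J] by (auto simp: ideal_cotorsion_pair_def)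
qed

section \<open>Completeness by Salce's argument\<close>

lemma injective_comp_phantom:
  assumes "injective_arr T A E e" "e \<in> Hom T B D" "\<theta> \<in> phantoms E" "\<theta> \<in> Hom T Z (SuspO T B)"
  shows "SuspA T e \<cdot> \<theta> = Zero T Z (SuspO T D)"
proof -
  obtain \<alpha> where a: "\<alpha> \<in> E" "\<alpha> \<in> Angles T" "last \<alpha> = \<theta>" "seq_obj T \<alpha> 0 = B" "seq_obj T \<alpha> (n - 1) = Z"
    by (rule phantom_angle[OF assms(3,4) Hom_Obj(1)[OF assms(2)]])
  note h = angle_homs[OF a(2)]
  have "hd \<alpha> \<in> inflations E" "Dom T (hd \<alpha>) = Dom T e"
    using a(1,4) h(9) Hom_Dom[OF assms(2)] by (auto simp: inflations_def)
  then obtain k where k: "k \<in> Hom T (Cod T (hd \<alpha>)) (Cod T e)" "e = k \<cdot> hd \<alpha>"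
    using assms(1) by (auto simp: injective_arr_def)
  have k': "k \<in> Hom T (seq_obj T \<alpha> 1) D" using k(1) Hom_Cod[OF h(6)] Hom_Cod[OF assms(2)] by simp
  \<comment> \<open>Since \<open>e\<close> extends along the inflation of an angle ending in
    \<open>\<theta>\<close>, the composite contains two consecutive morphisms of that angle.\<close>
  have "SuspA T e \<cdot> \<theta> = SuspA T k \<cdot> (SuspA T (hd \<alpha>) \<cdot> last \<alpha>)"
    using susp_comp[OF h(6) k'] comp_assoc[OF h(8) susp_hom[OF h(6)] susp_hom[OF k']] k(2) a(3) by simp
  then show ?thesis
    using SuspA_hd_comp_last[OF a(2)] comp_Zero[OF susp_hom[OF k'] h(12)] a(5) by simp
qed

text \<open>Dually, \<open>p\<close> lifts along the deflation of an angle ending in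
  \<open>\<theta>\<close>, and that deflation is killed by \<open>\<theta>\<close>.\<close>

lemma phantom_comp_projective:
  assumes "projective_arr T A E p" "p \<in> Hom T P Z" "\<theta> \<in> phantoms E" "\<theta> \<in> Hom T Z (SuspO T B)" "B \<in> Obj T"
  shows "\<theta> \<cdot> p = Zero T P (SuspO T B)"
proof -
  obtain \<alpha> where a: "\<alpha> \<in> E" "\<alpha> \<in> Angles T" "last \<alpha> = \<theta>" "seq_obj T \<alpha> 0 = B" "seq_obj T \<alpha> (n - 1) = Z"
    by (rule phantom_angle[OF assms(3,4,5)])
  note h = angle_homs[OF a(2)]
  have "last (butlast \<alpha>) \<in> deflations E" "Cod T (last (butlast \<alpha>)) = Cod T p"
    using a(1,5) Hom_Cod[OF h(7)] Hom_Cod[OF assms(2)] by (auto simp: deflations_def)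
  then obtain k where k: "k \<in> Hom T (Dom T p) (Dom T (last (butlast \<alpha>)))" "p = last (butlast \<alpha>) \<cdot> k"
    using assms(1) by (auto simp: projective_arr_def)
  have k': "k \<in> Hom T P (seq_obj T \<alpha> (n - 2))" using k(1) Hom_Dom[OF h(7)] Hom_Dom[OF assms(2)] by simp
  have "\<theta> \<cdot> p = (last \<alpha> \<cdot> last (butlast \<alpha>)) \<cdot> k"
    using comp_assoc[OF k' h(7,8)] k(2) a(3) by simp
  then show ?thesis
    using last_comp_last_butlast[OF a(2)] Zero_comp[OF k' SuspO_obj[OF h(11)]] a(4) by simp
qed

lemma special_preenveloping_right_perp:
  assumes I: "arr_ideal T A I" and "special_precovering T A E I" "enough_injectives T A E"
  shows "special_preenveloping T A E (right_perp T A E I)"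
  unfolding special_preenveloping_def
proof
  fix B assume B: "B \<in> A"
  then have BO: "B \<in> Obj T" using sub_obj by blast
  obtain e where e: "e \<in> inflations E" "Dom T e = B" "injective_arr T A E e"
    using assms(3) B by (auto simp: enough_injectives_def)
  obtain \<alpha> where a: "\<alpha> \<in> E" "hd \<alpha> = e" using e(1) by (auto simp: inflations_def)
  note aA = exact_angle[OF a(1)]
  note ah = angle_homs[OF aA]
  let ?C = "seq_obj T \<alpha> (n - 1)"
  have a0: "seq_obj T \<alpha> 0 = B" using ah(9) a(2) e(2) by simp
  have eh: "e \<in> Hom T B (seq_obj T \<alpha> 1)" using ah(6) a(2) a0 by simp
  have C: "?C \<in> A" using exact_angle_obj[OF a(1)] n_ge_3 by simp
  have lP: "last \<alpha> \<in> phantoms E" using a(1) by (auto simp: phantoms_def)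
  have lh: "last \<alpha> \<in> Hom T ?C (SuspO T B)" using ah(8) a0 by simp
  obtain i where i: "special_precover T A E I ?C i"
    using assms(2) C by (auto simp: special_precovering_def)
  then have iI: "i \<in> I" "Cod T i = ?C" by (auto simp: special_precover_def)
  let ?X = "Dom T i"
  have ih: "i \<in> Hom T ?X ?C" and X: "?X \<in> A"
    using sub_arrD(1,2)[OF arr_ideal_sub[OF I iI(1)]] iI(2) by auto
  note li = comp_hom[OF ih lh]
  \<comment> \<open>Base change of \<open>\<alpha>\<close> along the precover \<open>i\<close>; the
    first morphism of \<open>\<beta>\<close> will be the preenvelope.\<close>
  obtain \<beta> where b: "\<beta> \<in> Angles T" "last \<beta> = last \<alpha> \<cdot> i" "seq_obj T \<beta> 0 = B" "seq_obj T \<beta> (n - 1) = ?X"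
    by (rule ex_angle_last[OF li BO])
  note bh = angle_homs[OF b(1)]
  let ?g = "hd \<beta>" and ?Y = "seq_obj T \<beta> 1"
  have gh: "?g \<in> Hom T B ?Y" using bh(6) b(3) by simp
  \<comment> \<open>Both ends \<open>B\<close> and \<open>?X\<close> of \<open>\<beta>\<close> lie
    in \<open>A\<close>, so extension closure covers its second object.\<close>
  have Y: "?Y \<in> A" using angle_obj[OF b(1)] b(3,4) B X n_ge_3 by simp
  have "perp T E m ?g" if m: "m \<in> I" for m
  proof (rule perpI[OF _ gh])
    let ?W = "Dom T m" and ?Z = "Cod T m"
    note ms = arr_ideal_sub[OF I m]
    show mh: "m \<in> Hom T ?W ?Z" using sub_arrD(1)[OF ms] .
    fix \<theta> assume t: "\<theta> \<in> phantoms E" "\<theta> \<in> Hom T ?Z (SuspO T B)"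
    obtain h where h: "h \<in> Hom T ?Z ?C" "\<theta> = last \<alpha> \<cdot> h"
      using last_weak_kernel[OF aA _ injective_comp_phantom[OF e(3) eh t, folded a(2)]] t(2) a0 by auto
    \<comment> \<open>The ideal property turns \<open>m\<close> into a morphism of \<open>I\<close>
      ending at \<open>?C\<close>, the object for which the precover \<open>i\<close> was
      chosen.\<close>
    have hm: "h \<cdot> m \<in> I" using arr_ideal_comp_left[OF I m mh h(1) C] .
    obtain k where k: "k \<in> Hom T ?W ?X" "h \<cdot> m = i \<cdot> k"
      using special_precover_factors[OF i comp_hom[OF mh h(1)]] hm by (auto simp: right_perp_def)
    have tm: "\<theta> \<cdot> m = last \<beta> \<cdot> k"
      using h(2) comp_assoc[OF mh h(1) lh] comp_assoc[OF k(1) ih lh] k(2) b(2) by simp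
    have lb: "last \<beta> \<in> Hom T ?X (SuspO T B)" using li b(2) by simp
    show "SuspA T ?g \<cdot> (\<theta> \<cdot> m) = Zero T ?W (SuspO T ?Y)"
      using tm comp_assoc[OF k(1) lb susp_hom[OF gh]] SuspA_hd_comp_last[OF b(1)] b(4)
        Zero_comp[OF k(1) SuspO_obj[OF Hom_Obj(2)[OF gh]]] by simp
  qed
  then have gJ: "?g \<in> right_perp T A E I" using sub_arrI[OF gh B Y] by (simp add: right_perp_def)
  have iJ: "i \<in> left_perp T A E (right_perp T A E I)"
    using arr_ideal_sub[OF I iI(1)] iI(1) by (auto simp: left_perp_def right_perp_def)
  \<comment> \<open>The angle is \<open>\<beta>\<close>, and its last morphism is the phantom
    \<open>last \<alpha>\<close> after \<open>i\<close>, where \<open>i\<close> lies in the double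
    orthogonal of \<open>I\<close>.\<close>
  have "special_preenvelope T A E (right_perp T A E I) B ?g"
    unfolding special_preenvelope_def
  proof (intro conjI bexI)
    show "hd \<beta> = ?g" by (rule refl)
    show "?g \<in> right_perp T A E I" by (rule gJ)
    show "Dom T ?g = B" using Hom_Dom[OF gh] .
    show "\<beta> \<in> Angles T" by (rule b(1))
    show "Dom T i = Dom T (last \<beta>)" using b(4) bh(10) by simp
    show "last \<beta> = last \<alpha> \<cdot> i" by (rule b(2))
    show "last \<alpha> \<in> phantoms E \<inter> Hom T (Cod T i) (SuspO T B)" using lP lh iI(2) by simp
    show "i \<in> left_perp T A E (right_perp T A E I)" by (rule iJ)
  qed
  then show "\<exists>j. special_preenvelope T A E (right_perp T A E I) B j" by blast
qed

text \<open>Start from an angle whose deflation onto \<open>C\<close> is projective, and take a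
  special preenvelope \<open>j\<close> of its first object. Cobase change along \<open>j\<close>
  gives an angle whose deflation is the required special precover.\<close>

lemma special_precovering_left_perp:
  assumes J: "arr_ideal T A J" and "special_preenveloping T A E J" "enough_projectives T A E"
  shows "special_precovering T A E (left_perp T A E J)"
  unfolding special_precovering_def
proof
  fix C assume C: "C \<in> A"
  then have CO: "C \<in> Obj T" using sub_obj by blast
  obtain p where p: "p \<in> deflations E" "Cod T p = C" "projective_arr T A E p"
    using assms(3) C by (auto simp: enough_projectives_def)
  obtain \<alpha> where a: "\<alpha> \<in> E" "last (butlast \<alpha>) = p" using p(1) by (auto simp: deflations_def)
  note aA = exact_angle[OF a(1)]
  note ah = angle_homs[OF aA]
  let ?B = "seq_obj T \<alpha> 0"
  have an: "seq_obj T \<alpha> (n - 1) = C" using Hom_Cod[OF ah(7)] a(2) p(2) by simp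
  have pH: "p \<in> Hom T (seq_obj T \<alpha> (n - 2)) C" using ah(7) a(2) an by simp
  have B: "?B \<in> A" using exact_angle_obj[OF a(1)] n_ge_3 by simp
  have lP: "last \<alpha> \<in> phantoms E" using a(1) by (auto simp: phantoms_def)
  have lh: "last \<alpha> \<in> Hom T C (SuspO T ?B)" using ah(8) an by simp
  obtain j where j: "special_preenvelope T A E J ?B j"
    using assms(2) B by (auto simp: special_preenveloping_def)
  then have jJ: "j \<in> J" "Dom T j = ?B" by (auto simp: special_preenvelope_def)
  let ?Y = "Cod T j"
  have jh: "j \<in> Hom T ?B ?Y" and Y: "?Y \<in> A"
    using sub_arrD(1,3)[OF arr_ideal_sub[OF J jJ(1)]] jJ(2) by auto
  note lj = comp_hom[OF lh susp_hom[OF jh]]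
  obtain \<beta> where b: "\<beta> \<in> Angles T" "last \<beta> = SuspA T j \<cdot> last \<alpha>" "seq_obj T \<beta> 0 = ?Y" "seq_obj T \<beta> (n - 1) = C"
    by (rule ex_angle_last[OF lj Hom_Obj(2)[OF jh]])
  note bh = angle_homs[OF b(1)]
  let ?g = "last (butlast \<beta>)" and ?X = "seq_obj T \<beta> (n - 2)"
  have gh: "?g \<in> Hom T ?X C" using bh(7) b(4) by simp
  have X: "?X \<in> A" using angle_obj[OF b(1)] b(3,4) C Y n_ge_3 by simp
  have "perp T E ?g m" if m: "m \<in> J" for m
  proof (rule perpI[OF gh])
    let ?Z = "Dom T m" and ?W = "Cod T m"
    note ms = arr_ideal_sub[OF J m]
    show mh: "m \<in> Hom T ?Z ?W" using sub_arrD(1)[OF ms] .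
    have Z: "?Z \<in> Obj T" using Hom_Obj(1)[OF mh] .
    fix \<theta> assume t: "\<theta> \<in> phantoms E" "\<theta> \<in> Hom T C (SuspO T ?Z)"
    \<comment> \<open>The projective \<open>p\<close> is killed by \<open>\<theta>\<close>, so
      \<open>\<theta>\<close> factors through \<open>last \<alpha>\<close> on the other
      side.\<close>
    obtain h where h: "h \<in> Hom T ?B ?Z" "\<theta> = SuspA T h \<cdot> last \<alpha>"
      using last_weak_cokernel[OF aA _ Z phantom_comp_projective[OF p(3) pH t Z, folded a(2)]] t(2) an
      by auto
    have mhJ: "m \<cdot> h \<in> J" using arr_ideal_comp_right[OF J m mh h(1) B] .
    obtain k where k: "k \<in> Hom T ?Y ?W" "m \<cdot> h = k \<cdot> j"
      using special_preenvelope_factors[OF j comp_hom[OF h(1) mh]] mhJ by (auto simp: left_perp_def)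
    have lb: "last \<beta> \<in> Hom T C (SuspO T ?Y)" using lj b(2) by simp
    note sm = susp_hom[OF mh] and sk = susp_hom[OF k(1)]
    \<comment> \<open>Both sides are \<open>last \<alpha>\<close> followed by the suspension of
      \<open>m \<cdot> h\<close>, which equals \<open>k \<cdot> j\<close>.\<close>
    have "SuspA T m \<cdot> \<theta> = SuspA T k \<cdot> last \<beta>"
      using h(2) comp_assoc[OF lh susp_hom[OF h(1)] sm] comp_assoc[OF lh susp_hom[OF jh] sk]
        susp_comp[OF h(1) mh] susp_comp[OF jh k(1)] k(2) b(2) by simp
    then show "SuspA T m \<cdot> (\<theta> \<cdot> ?g) = Zero T ?X (SuspO T ?W)"
      using comp_assoc[OF gh t(2) sm] comp_assoc[OF gh lb sk] last_comp_last_butlast[OF b(1)] b(3)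
        comp_Zero[OF sk Hom_Obj(1)[OF gh]] by simp
  qed
  then have gI: "?g \<in> left_perp T A E J" using sub_arrI[OF gh X C] by (simp add: left_perp_def)
  have jI: "j \<in> right_perp T A E (left_perp T A E J)"
    using arr_ideal_sub[OF J jJ(1)] jJ(1) by (auto simp: left_perp_def right_perp_def)
  \<comment> \<open>The last morphism of \<open>\<beta>\<close> is the phantom
    \<open>last \<alpha>\<close> followed by the suspension of \<open>j\<close>, and
    \<open>j\<close> lies in the double orthogonal of \<open>J\<close>.\<close>
  have "special_precover T A E (left_perp T A E J) C ?g"
    unfolding special_precover_def
  proof (intro conjI bexI)
    show "last (butlast \<beta>) = ?g" by (rule refl)
    show "?g \<in> left_perp T A E J" by (rule gI)
    show "Cod T ?g = C" using Hom_Cod[OF gh] .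
    show "\<beta> \<in> Angles T" by (rule b(1))
    show "Cod T j = Dom T (hd \<beta>)" using b(3) bh(9) by simp
    show "last \<beta> = SuspA T j \<cdot> last \<alpha>" by (rule b(2))
    show "last \<alpha> \<in> phantoms E \<inter> Hom T C (SuspO T (Dom T j))" using lP lh jJ(2) by simp
    show "j \<in> right_perp T A E (left_perp T A E J)" by (rule jI)
  qed
  then show "\<exists>i. special_precover T A E (left_perp T A E J) C i" by blast
qed

end

theorem theorem3p19:
  fixes n :: nat
    and T :: "('o, 'm) angulated_data"
    and A :: "'o set"
    and E :: "'m list set"
    and I J :: "'m set"
  assumes "n_angulated_category n T"
    and "A \<subseteq> Obj T"
    and "iso_closed T A"
    and "extension_closed T A"
    and "almost_n_exact_structure T A E"
    and "arr_ideal T A I"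
    and "arr_ideal T A J"
  shows "(special_precovering T A E I \<longrightarrow>
            ideal_cotorsion_pair T A E I (right_perp T A E I) \<and>
            (enough_injectives T A E \<longrightarrow>
               complete_ideal_cotorsion_pair T A E I (right_perp T A E I))) \<and>
         (special_preenveloping T A E J \<longrightarrow>
            ideal_cotorsion_pair T A E (left_perp T A E J) J \<and>
            (enough_projectives T A E \<longrightarrow>
               complete_ideal_cotorsion_pair T A E (left_perp T A E J) J))"
proof -
  have exact: "almost_n_exact_category n T A E"
    by (intro almost_n_exact_category.intro almost_n_exact_category_axioms.intro assms)
  \<comment> \<open>In each part one half of completeness is the assumption itself, and Salce's
    argument supplies the other half.\<close>
  show ?thesis
    unfolding complete_ideal_cotorsion_pair_def
    by (intro conjI impI
        almost_n_exact_category.special_precovering_cotorsion_pair[OF exact assms(6)]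
        almost_n_exact_category.special_preenveloping_right_perp[OF exact assms(6)]
        almost_n_exact_category.special_preenveloping_cotorsion_pair[OF exact assms(7)]
        almost_n_exact_category.special_precovering_left_perp[OF exact assms(7)])
qed

end
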